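(* Let $\Phi=\{\varphi_i\}_{i\in I}$ and $\Psi=\{\psi_j\}_{j\in J}$ be two IFSs on $\mathbb{R}^d$, with self-similar sets $E$ and $F$ respectively, where $F$ is non-trivial (i.e. $F$ is not a single point). For $j\in J$ let $r_j'$ denote the contraction ratio of $\psi_j$. Suppose that the following properties hold: 1. $\Phi$ satisfies the strong separation condition. 2. There exist $r_1,r_2\in(0,1)$ and $I_1,I_2\subset I$ such that $\Phi=\{\varphi_{i,1}=r_1O_{i,1}+t_{i,1}\}_{i\in I_1}\cup\{\varphi_{i,2}=r_2O_{i,2}+t_{i,2}\}_{i\in I_2}$, where the $O_{i,1},O_{i,2}$ are $d\times d$ orthogonal matrices and $t_{i,1},t_{i,2}\in\mathbb{R}^d$ (that is, every similarity in $\Phi$ has contraction ratio $r_1$ or $r_2$). 3. There exists $j^*\in J$ such that: (a) $\psi_{j^*}=r_{j^*}'I_d+t_{j^*}$ for some $t_{j^*}\in\mathbb{R}^d$, where $I_d$ is the $d\times d$ identity matrix; (b) there exist $\tau_1,\tau_2\geq 2$ satisfying $2\tau_1<\tau_2+2$ and $$-\frac{\log r_1}{\log r_{j^*}'}\in E(\tau_1)\quad\text{and}\quad -\frac{\log r_2}{\log r_{j^*}'}\in W(\tau_2).$$ If $\dim_H(E)<\frac{1}{2}\left(1-\frac{2(\tau_1-1)}{\tau_2}\right)$, then $F$ cannot be affinely embedded into $E$.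
   Context: A map $\varphi:\mathbb{R}^d\to\mathbb{R}^d$ is a similarity if $\varphi(x)=r\,Ox+t$ for some $r\in(0,1)$ (its contraction ratio), some $d\times d$ orthogonal matrix $O$ and some $t\in\mathbb{R}^d$; this is abbreviated $\varphi=r\cdot O+t$. An iterated function system (IFS) is a finite set $\Phi=\{\varphi_i\}_{i\in I}$ of similarities of $\mathbb{R}^d$; its self-similar set is the unique non-empty compact set $K\subset\mathbb{R}^d$ with $K=\bigcup_{i\in I}\varphi_i(K)$. $\Phi$ satisfies the strong separation condition if its self-similar set $K$ satisfies $\varphi_i(K)\cap\varphi_j(K)=\emptyset$ for all $i\neq j$ in $I$. For $A,B\subset\mathbb{R}^d$, $A$ can be affinely embedded into $B$ if there is a map $f:\mathbb{R}^d\to\mathbb{R}^d$ of the form $f(x)=Mx+a$, with $M$ an invertible $d\times d$ matrix and $a\in\mathbb{R}^d$, such that $f(A)\subset B$. For real $\tau\geq 2$, $W(\tau)$ denotes the set of $x\in\mathbb{R}\setminus\mathbb{Q}$ for which there exist infinitely many $(p,q)\in\mathbb{Z}\times\mathbb{N}$ (with $q\geq 1$) satisfying $\left|x-\frac{p}{q}\right|<\frac{1}{q^{\tau}}$. For $x\in\mathbb{R}\setminus\mathbb{Q}$ the exact order of $x$ is $\tau(x):=\sup\{\tau\geq 2: x\in W(\tau)\}\in[2,\infty]$. For $\tau\in[2,\infty)\cup\{\infty\}$, $E(\tau)$ denotes the set of $x\in\mathbb{R}\setminus\mathbb{Q}$ with $\tau(x)=\tau$ (not to be confused with the self-similar set $E$).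 $\dim_H$ denotes Hausdorff dimension. *)

theory Defs
  imports "HOL-Analysis.Analysis"
begin

section \<open>Similarities and iterated function systems\<close>

definition sim_map :: "real \<Rightarrow> real^'n^'n \<Rightarrow> real^'n \<Rightarrow> real^'n \<Rightarrow> real^'n" where
  "sim_map r Q t = (\<lambda>x. r *\<^sub>R (Q *v x) + t)"

definition has_contraction_ratio :: "(real^'n \<Rightarrow> real^'n) \<Rightarrow> real \<Rightarrow> bool" where
  "has_contraction_ratio f r \<longleftrightarrow>
     0 < r \<and> r < 1 \<and> (\<exists>Q t. orthogonal_matrix Q \<and> f = sim_map r Q t)"

definition similarity :: "(real^'n \<Rightarrow> real^'n) \<Rightarrow> bool" where
  "similarity f \<longleftrightarrow> (\<exists>r. has_contraction_ratio f r)"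

definition contraction_ratio :: "(real^'n \<Rightarrow> real^'n) \<Rightarrow> real" where
  "contraction_ratio f = (THE r. has_contraction_ratio f r)"

text \<open>The index set has to be non-empty, since otherwise no non-empty self-similar set exists.\<close>

definition IFS :: "'i set \<Rightarrow> ('i \<Rightarrow> real^'n \<Rightarrow> real^'n) \<Rightarrow> bool" where
  "IFS I \<phi> \<longleftrightarrow> finite I \<and> I \<noteq> {} \<and> (\<forall>i\<in>I. similarity (\<phi> i))"

text \<open>The definite description is justified for every IFS by the lemma
  \<open>ex1_self_similar_set\<close> below.\<close>

definition self_similar_set :: "'i set \<Rightarrow> ('i \<Rightarrow> real^'n \<Rightarrow> real^'n) \<Rightarrow> (real^'n) set" where
  "self_similar_set I \<phi> = (THE K. compact K \<and> K \<noteq> {} \<and> K = (\<Union>i\<in>I. \<phi> i ` K))"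

definition strong_separation :: "'i set \<Rightarrow> ('i \<Rightarrow> real^'n \<Rightarrow> real^'n) \<Rightarrow> bool" where
  "strong_separation I \<phi> \<longleftrightarrow>
     (\<forall>i\<in>I. \<forall>j\<in>I. i \<noteq> j \<longrightarrow>
        \<phi> i ` self_similar_set I \<phi> \<inter> \<phi> j ` self_similar_set I \<phi> = {})"

definition affinely_embeds :: "(real^'n) set \<Rightarrow> (real^'n) set \<Rightarrow> bool" where
  "affinely_embeds A B \<longleftrightarrow> (\<exists>M a. invertible M \<and> (\<lambda>x. M *v x + a) ` A \<subseteq> B)"


section \<open>Exact approximation order\<close>

definition W :: "real \<Rightarrow> real set" where
  "W \<tau> = {x. x \<notin> \<rat> \<and>
      infinite {(p::int, q::nat). q \<ge> 1 \<and> \<bar>x - of_int p / of_nat q\<bar> < 1 / real q powr \<tau>}}"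

definition exact_order :: "real \<Rightarrow> ereal" where
  "exact_order x = Sup (ereal ` {\<tau>. \<tau> \<ge> 2 \<and> x \<in> W \<tau>})"

definition exact_order_set :: "ereal \<Rightarrow> real set" where
  "exact_order_set \<tau> = {x. x \<notin> \<rat> \<and> exact_order x = \<tau>}"


section \<open>Hausdorff dimension\<close>

text \<open>The \<open>s\<close>-th power of the diameter, with the usual conventions that the empty set
  contributes 0 and that a non-empty set contributes 1 for \<open>s = 0\<close>
  (note that \<open>0 powr 0 = 0\<close> in HOL).\<close>

definition diam_pow :: "real \<Rightarrow> 'a::metric_space set \<Rightarrow> ennreal" where
  "diam_pow s U = (if U = {} then 0 else if s = 0 then 1 else ennreal (diameter U powr s))"

text \<open>Boundedness is required of covering sets because \<^const>\<open>diameter\<close> is real-valued and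
  carries no information for unbounded sets.\<close>

definition hausdorff_premeasure :: "real \<Rightarrow> real \<Rightarrow> 'a::metric_space set \<Rightarrow> ennreal" where
  "hausdorff_premeasure \<delta> s A =
     (INF U \<in> {U :: nat \<Rightarrow> 'a set. A \<subseteq> (\<Union>k. U k) \<and> (\<forall>k. bounded (U k) \<and> diameter (U k) \<le> \<delta>)}.
        \<Sum>k. diam_pow s (U k))"

definition hausdorff_measure :: "real \<Rightarrow> 'a::metric_space set \<Rightarrow> ennreal" where
  "hausdorff_measure s A = (SUP \<delta> \<in> {0<..}. hausdorff_premeasure \<delta> s A)"

definition hausdorff_dim :: "'a::metric_space set \<Rightarrow> ereal" where
  "hausdorff_dim A = Inf (ereal ` {s. 0 \<le> s \<and> hausdorff_measure s A = 0})"


section \<open>Well-definedness of the contraction ratio and of the self-similar set\<close>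

lemma dist_sim_map:
  assumes "orthogonal_matrix Q" "0 \<le> r"
  shows "dist (sim_map r Q t x) (sim_map r Q t y) = r * dist x y"
proof -
  have "orthogonal_transformation ((*v) Q)"
    using assms(1) by (simp add: orthogonal_transformation_matrix)
  then have "norm (Q *v (x - y)) = norm (x - y)"
    by (rule orthogonal_transformation_norm)
  then show ?thesis
    using assms(2)
    by (simp add: sim_map_def dist_norm matrix_vector_mult_diff_distrib flip: scaleR_diff_right)
qed

lemma has_contraction_ratio_dist:
  "has_contraction_ratio f r \<Longrightarrow> dist (f x) (f y) = r * dist x y"
  by (auto simp: has_contraction_ratio_def dist_sim_map)

lemma contraction_ratio_eq:
  fixes f :: "real^'n \<Rightarrow> real^'n"
  assumes "has_contraction_ratio f r"
  shows "contraction_ratio f = r"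
  unfolding contraction_ratio_def
proof (rule the_equality)
  fix r' assume "has_contraction_ratio f r'"
  then have "r' * dist (1 :: real^'n) 0 = r * dist (1 :: real^'n) 0"
    using has_contraction_ratio_dist[OF assms, of 1 0] has_contraction_ratio_dist[of f r' 1 0]
    by simp
  then show "r' = r" by simp
qed (fact assms)

lemma self_similar_set_subset:
  fixes K K' :: "(real^'n) set"
  assumes ifs: "IFS I \<phi>"
    and K: "compact K" "K \<noteq> {}" "K = (\<Union>i\<in>I. \<phi> i ` K)"
    and K': "compact K'" "K' \<noteq> {}" "K' = (\<Union>i\<in>I. \<phi> i ` K')"
  shows "K \<subseteq> K'"
proof -
  have "continuous_on K (\<lambda>x. infdist x K')"
    by (intro continuous_intros)
  then obtain m where m: "m \<in> K" "\<And>x. x \<in> K \<Longrightarrow> infdist x K' \<le> infdist m K'"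
    using continuous_attains_sup[OF K(1,2)] by blast
  obtain i y where i: "i \<in> I" "y \<in> K" "m = \<phi> i y"
    using K(3) m(1) by blast
  obtain r where r: "has_contraction_ratio (\<phi> i) r" "0 < r" "r < 1"
    using ifs i(1) unfolding IFS_def similarity_def has_contraction_ratio_def by blast
  obtain z where z: "z \<in> K'" "infdist y K' = dist y z"
    using infdist_attains_inf[OF compact_imp_closed[OF K'(1)] K'(2), of y] by metis
  have "\<phi> i z \<in> K'" using z(1) i(1) K'(3) by blast
  then have "infdist m K' \<le> dist m (\<phi> i z)" by (rule infdist_le)
  also have "\<dots> = r * infdist y K'"
    using i(3) z(2) has_contraction_ratio_dist[OF r(1)] by simp
  also have "\<dots> \<le> r * infdist m K'" using m(2)[OF i(2)] r by simp
  finally have "(1 - r) * infdist m K' \<le> 0" by (simp add: algebra_simps)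
  then have le: "infdist m K' \<le> 0" using r by (simp add: mult_le_0_iff)
  show ?thesis
  proof
    fix x assume "x \<in> K"
    then have "infdist x K' = 0" using m(2) le infdist_nonneg[of x K'] by (meson order.antisym order.trans)
    then show "x \<in> K'"
      using in_closed_iff_infdist_zero K'(1,2) compact_imp_closed by blast
  qed
qed

lemma ex_self_similar_set:
  fixes \<phi> :: "'i \<Rightarrow> real^'n \<Rightarrow> real^'n"
  assumes ifs: "IFS I \<phi>"
  shows "\<exists>K. compact K \<and> K \<noteq> {} \<and> K = (\<Union>i\<in>I. \<phi> i ` K)"
proof -
  have fin: "finite I" and ne: "I \<noteq> {}" using ifs by (auto simp: IFS_def)
  have "\<forall>i\<in>I. \<exists>r. has_contraction_ratio (\<phi> i) r" using ifs by (auto simp: IFS_def similarity_def)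
  then obtain r where r: "\<And>i. i \<in> I \<Longrightarrow> has_contraction_ratio (\<phi> i) (r i)" by metis
  have r01: "0 < r i" "r i < 1" if "i \<in> I" for i
    using r[OF that] by (auto simp: has_contraction_ratio_def)
  have d: "dist (\<phi> i x) (\<phi> i y) = r i * dist x y" if "i \<in> I" for i x y
    using has_contraction_ratio_dist[OF r[OF that]] .
  have cont: "continuous_on S (\<phi> i)" if "i \<in> I" for i S
  proof -
    have "(r i)-lipschitz_on S (\<phi> i)"
      using d[OF that] r01[OF that] by (intro lipschitz_onI) auto
    then show ?thesis by (rule lipschitz_on_continuous_on)
  qed
  define R where "R = Max ((\<lambda>i. norm (\<phi> i 0) / (1 - r i)) ` I)"
  define B where "B = cball (0::real^'n) R"
  have Rge: "norm (\<phi> i 0) \<le> R * (1 - r i)" if "i \<in> I" for i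
  proof -
    have "norm (\<phi> i 0) / (1 - r i) \<le> R" unfolding R_def using fin that by (intro Max_ge) auto
    then show ?thesis using r01[OF that] by (simp add: field_simps)
  qed
  have R0: "0 \<le> R"
  proof -
    obtain i where "i \<in> I" using ne by blast
    then have "0 \<le> R * (1 - r i)" "0 < 1 - r i"
      using Rge[of i] r01[of i] norm_ge_zero[of "\<phi> i 0"] by linarith+
    then show ?thesis by (simp add: zero_le_mult_iff)
  qed
  define T where "T S = (\<Union>i\<in>I. \<phi> i ` S)" for S
  have Tmono: "T S \<subseteq> T S'" if "S \<subseteq> S'" for S S' using that unfolding T_def by blast
  have TB: "T B \<subseteq> B"
  proof
    fix y assume "y \<in> T B"
    then obtain i x where ix: "i \<in> I" "norm x \<le> R" "y = \<phi> i x" by (auto simp: T_def B_def)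
    have "norm y \<le> dist (\<phi> i x) (\<phi> i 0) + norm (\<phi> i 0)"
      using ix(3) norm_triangle_ineq[of "\<phi> i x - \<phi> i 0" "\<phi> i 0"] by (simp add: dist_norm)
    also have "\<dots> \<le> r i * R + R * (1 - r i)"
      using d[OF ix(1)] Rge[OF ix(1)] ix(2) r01[OF ix(1)] by (intro add_mono) auto
    finally show "y \<in> B" by (simp add: B_def algebra_simps)
  qed
  define F where "F n = (T ^^ n) B" for n
  have FSuc: "F (Suc n) = T (F n)" for n by (simp add: F_def)
  have Fcn: "compact (F n) \<and> F n \<noteq> {}" for n
  proof (induction n)
    case 0
    then show ?case using R0 by (simp add: F_def B_def)
  next
    case (Suc n)
    then show ?case unfolding FSuc T_def using fin ne cont
      by (auto intro!: compact_UN compact_continuous_image)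
  qed
  have "F (Suc n) \<subseteq> F n" for n
  proof (induction n)
    case 0
    then show ?case using TB by (simp add: F_def)
  next
    case (Suc n)
    then show ?case using Tmono FSuc by metis
  qed
  then have Fdec: "F n \<subseteq> F m" if "m \<le> n" for m n
    using that by (rule lift_Suc_antimono_le)
  define K where "K = (\<Inter>n. F n)"
  have "K \<noteq> {}" unfolding K_def by (rule compact_nest) (use Fcn Fdec in auto)
  moreover have "compact K" unfolding K_def using Fcn by (intro compact_Inter) auto
  moreover have "T K \<subseteq> K"
  proof -
    have "T K \<subseteq> F n" for n
    proof -
      have "T K \<subseteq> F (Suc n)" unfolding FSuc by (rule Tmono) (auto simp: K_def)
      also have "\<dots> \<subseteq> F n" by (rule Fdec) simp
      finally show ?thesis .
    qed
    then show ?thesis unfolding K_def by blast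
  qed
  moreover have "K \<subseteq> T K"
  proof
    fix y assume y: "y \<in> K"
    define G where "G n = F n \<inter> (\<Union>i\<in>I. \<phi> i -` {y})" for n
    have cl: "closed (\<Union>i\<in>I. \<phi> i -` {y})"
      using fin cont by (intro closed_UN ballI closed_vimage) auto
    have "(\<Inter>n. G n) \<noteq> {}"
    proof (rule compact_nest)
      show "compact (G n)" for n unfolding G_def using Fcn cl by (intro compact_Int_closed) auto
      show "G n \<noteq> {}" for n
      proof -
        have "y \<in> T (F n)" using y unfolding K_def FSuc[symmetric] by blast
        then show ?thesis unfolding G_def T_def by blast
      qed
      show "G n \<subseteq> G m" if "m \<le> n" for m n using Fdec[OF that] unfolding G_def by blast
    qed
    then obtain x where "x \<in> (\<Inter>n. G n)" by blast
    then show "y \<in> T K" unfolding G_def K_def T_def by blast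
  qed
  ultimately show ?thesis unfolding T_def by blast
qed

lemma ex1_self_similar_set:
  fixes \<phi> :: "'i \<Rightarrow> real^'n \<Rightarrow> real^'n"
  assumes "IFS I \<phi>"
  shows "\<exists>!K. compact K \<and> K \<noteq> {} \<and> K = (\<Union>i\<in>I. \<phi> i ` K)"
proof (rule ex_ex1I)
  show "\<exists>K. compact K \<and> K \<noteq> {} \<and> K = (\<Union>i\<in>I. \<phi> i ` K)"
    by (rule ex_self_similar_set[OF assms])
next
  fix K K'
  assume K: "compact K \<and> K \<noteq> {} \<and> K = (\<Union>i\<in>I. \<phi> i ` K)"
    and K': "compact K' \<and> K' \<noteq> {} \<and> K' = (\<Union>i\<in>I. \<phi> i ` K')"
  note K = K[THEN conjunct1] K[THEN conjunct2, THEN conjunct1] K[THEN conjunct2, THEN conjunct2]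
  note K' = K'[THEN conjunct1] K'[THEN conjunct2, THEN conjunct1] K'[THEN conjunct2, THEN conjunct2]
  show "K = K'"
    by (rule subset_antisym)
      (rule self_similar_set_subset[OF assms K K'] self_similar_set_subset[OF assms K' K])+
qed

lemma self_similar_set:
  assumes "IFS I \<phi>"
  shows "compact (self_similar_set I \<phi>)" "self_similar_set I \<phi> \<noteq> {}"
    "self_similar_set I \<phi> = (\<Union>i\<in>I. \<phi> i ` self_similar_set I \<phi>)"
proof -
  note * = theI'[OF ex1_self_similar_set[OF assms], folded self_similar_set_def]
  show "compact (self_similar_set I \<phi>)" by (rule *[THEN conjunct1])
  show "self_similar_set I \<phi> \<noteq> {}" by (rule *[THEN conjunct2, THEN conjunct1])
  show "self_similar_set I \<phi> = (\<Union>i\<in>I. \<phi> i ` self_similar_set I \<phi>)"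
    by (rule *[THEN conjunct2, THEN conjunct2])
qed

end

theory Submission
  imports Defs
begin

text \<open>
  Suppose that an affine bijection maps \<open>F\<close> into \<open>E\<close>, and let \<open>\<rho>\<close> be the ratio of the homothety among
  the maps of \<open>F\<close>. The image of \<open>F\<close> is invariant under a homothety of ratio \<open>\<rho>\<close> about some point \<open>y\<close>,
  so \<open>E\<close> contains \<open>y\<close> and, for some \<open>l > 0\<close>, points \<open>z n\<close> at distance \<open>l * \<rho> ^ n\<close> from \<open>y\<close>
  (\<open>affine_image_geometric_sequence\<close>).

  Now zoom in on \<open>y\<close>. By strong separation, the points of \<open>E\<close> close to \<open>y\<close> lie in a cylinder around \<open>y\<close>,
  of some ratio \<open>R\<close>, and blowing this cylinder up to \<open>E\<close> turns the pair \<open>y\<close>, \<open>z n\<close> into two points of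
  \<open>E\<close> at distance \<open>l * \<rho> ^ n / R\<close> (\<open>zoomed_pair\<close>). Here \<open>R = r\<^sub>1 ^ a * r\<^sub>2 ^ b\<close>, so modulo 1 and up to a
  constant the logarithm of this distance to base \<open>\<rho>\<close> is \<open>a * \<alpha> + b * \<beta>\<close>, where
  \<open>\<alpha> = - (ln r\<^sub>1 / ln \<rho>)\<close> and \<open>\<beta> = - (ln r\<^sub>2 / ln \<rho>)\<close>. As the level of the cylinder grows, exactly one
  of \<open>a\<close> and \<open>b\<close> increases by 1 at a time: these numbers form an orbit on the circle whose steps are
  \<open>\<alpha>\<close> or \<open>\<beta>\<close>, in an order over which there is no control.

  Two estimates then collide. Distances between points of \<open>E\<close> are determined, up to a small error, by
  pairs of balls covering \<open>E\<close>. For a self-similar set with separated pieces the covering numbers at scale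
  \<open>\<delta>\<close> are \<open>O (\<delta> powr (- s))\<close> as soon as the \<open>s\<close>-dimensional Hausdorff measure vanishes
  (\<open>covering_numbers_of_hausdorff_null\<close>), so the orbit has at most \<open>O (\<delta> powr (- 2 * s))\<close> points that
  are \<open>\<delta>\<close>-separated (\<open>card_separated_times_le\<close>). On the other hand, whatever the order of the steps, at
  suitable arbitrarily small scales it has more than \<open>\<delta> powr (- v)\<close> such points for every
  \<open>v < 1 - 2 * (\<tau>\<^sub>1 - 1) / \<tau>\<^sub>2\<close> (\<open>alpha_beta_orbit_separated_subset\<close>). The reason is that a very good
  rational approximation \<open>p / q\<close> of \<open>\<beta>\<close> makes \<open>\<beta>\<close>-steps invisible after multiplication by \<open>q\<close>, while
  the multiples of \<open>q * \<alpha>\<close> are spread out because \<open>\<alpha>\<close> is not too well approximable. The assumed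
  bound on the dimension of \<open>E\<close> allows \<open>v = 2 * s\<close>, and the two estimates contradict each other.
\<close>


section \<open>Rational approximation of irrational numbers\<close>

lemma abs_denominator_mult:
  fixes x :: real
  assumes "0 < q"
  shows "\<bar>real q * x - of_int p\<bar> = q * \<bar>x - p / q\<bar>"
proof -
  have "real q * x - of_int p = q * (x - p / q)" using assms by (simp add: right_diff_distrib)
  then show ?thesis by (simp only: abs_mult abs_of_nat)
qed

text \<open>Every denominator has a nearest fraction, which misses the irrational number \<open>x\<close>, and only
  finitely many denominators are allowed.\<close>

lemma irrational_apart_from_small_denominators:
  fixes x :: real and N :: nat
  assumes "x \<notin> \<rat>"
  obtains e where "0 < e" and "\<And>(p::int) (q::nat). 0 < q \<Longrightarrow> q \<le> N \<Longrightarrow> e \<le> \<bar>x - p / q\<bar>"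
proof -
  define d where "d q = \<bar>real q * x - round (real q * x)\<bar> / q" for q :: nat
  define e where "e = Min (insert 1 (d ` {1..N}))"
  have d_pos: "0 < d q" if "0 < q" for q
  proof -
    have "real q * x \<noteq> round (real q * x)"
    proof
      assume "real q * x = round (real q * x)"
      then have "x = round (real q * x) / real q" using that by (simp add: field_simps)
      then show False using assms by (metis Rats_divide Rats_of_int Rats_of_nat)
    qed
    then show ?thesis using that by (simp add: d_def)
  qed
  show thesis
  proof
    show "0 < e" unfolding e_def using d_pos by (subst Min_gr_iff) auto
    fix p :: int and q :: nat assume q: "0 < q" "q \<le> N"
    have "e \<le> d q" unfolding e_def using q by (intro Min_le) auto
    also have "d q \<le> \<bar>real q * x - p\<bar> / q"
      unfolding d_def using round_diff_minimal[of "real q * x" p] by (intro divide_right_mono) auto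
    also have "\<dots> = \<bar>(real q * x - p) / q\<bar>" by simp
    also have "(real q * x - p) / q = x - p / q" using q by (simp add: field_simps)
    finally show "e \<le> \<bar>x - p / q\<bar>" .
  qed
qed

text \<open>For \<open>s\<close> above the exact order, only finitely many fractions violate the bound with
  constant 1. Their denominators are bounded, so a smaller constant accommodates them.\<close>

lemma diophantine_of_exact_order:
  fixes x :: real
  assumes x: "x \<in> exact_order_set (ereal t)" and "2 \<le> t" "t < s"
  obtains c where "0 < c" and "\<And>(p::int) (q::nat). 0 < q \<Longrightarrow> c * real q powr (1 - s) \<le> \<bar>q * x - p\<bar>"
proof -
  have irr: "x \<notin> \<rat>" and ord: "exact_order x = ereal t" using x by (auto simp: exact_order_set_def)
  have "x \<notin> W s"
  proof
    assume "x \<in> W s"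
    then have "ereal s \<le> exact_order x"
      unfolding exact_order_def using assms by (intro Sup_upper) auto
    then show False using ord \<open>t < s\<close> by simp
  qed
  define A where "A = {(p::int, q::nat). q \<ge> 1 \<and> \<bar>x - of_int p / of_nat q\<bar> < 1 / real q powr s}"
  have "finite A" using \<open>x \<notin> W s\<close> irr by (simp add: W_def A_def)
  then have "finite (snd ` A)" by simp
  then obtain N where N: "\<And>q. q \<in> snd ` A \<Longrightarrow> q \<le> N" by (meson finite_nat_set_iff_bounded_le)
  obtain e where e: "0 < e" "\<And>(p::int) (q::nat). 0 < q \<Longrightarrow> q \<le> N \<Longrightarrow> e \<le> \<bar>x - p / q\<bar>"
    using irrational_apart_from_small_denominators[OF irr, of N] by metis
  show thesis
  proof
    show "0 < min 1 e" using e by simp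
    fix p :: int and q :: nat assume q: "0 < q"
    note * = abs_denominator_mult[OF q, of x p]
    show "min 1 e * real q powr (1 - s) \<le> \<bar>q * x - p\<bar>"
    proof (cases "(p, q) \<in> A")
      case True
      then have "q \<le> N" using N by force
      then have "e \<le> \<bar>x - p / q\<bar>" using e q by simp
      moreover have "real q powr (1 - s) \<le> real q powr 0" using assms q by (intro powr_mono) auto
      ultimately have "min 1 e * real q powr (1 - s) \<le> \<bar>x - p / q\<bar> * 1"
        using e q by (intro mult_mono) auto
      also have "\<dots> \<le> \<bar>x - p / q\<bar> * q" using q by (intro mult_left_mono) auto
      finally show ?thesis using * by (simp add: mult.commute)
    next
      case False
      then have "1 / real q powr s \<le> \<bar>x - p / q\<bar>" using q by (auto simp: A_def)
      then have "q * (1 / real q powr s) \<le> \<bar>q * x - p\<bar>" unfolding * using q by (intro mult_left_mono) auto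
      moreover have "q * (1 / real q powr s) = real q powr (1 - s)" using q by (simp add: powr_diff)
      moreover have "min 1 e * real q powr (1 - s) \<le> 1 * real q powr (1 - s)" using e by (intro mult_right_mono) auto
      ultimately show ?thesis by simp
    qed
  qed
qed

text \<open>Cancelling common factors preserves a fraction and weakens the required inequality, but it
  might collapse large denominators to small ones. It does not: an irrational number keeps a positive
  distance from all fractions with small denominators, so a good enough approximation cannot reduce
  to one of those.\<close>

lemma large_reduced_approximation:
  assumes x: "x \<in> W t" and "1 \<le> t"
  obtains p :: int and q :: nat
  where "coprime p (int q)" and "N < q" and "\<bar>x - p / q\<bar> < 1 / real q powr t"
proof -
  define A where "A = {(p::int, q::nat). q \<ge> 1 \<and> \<bar>x - of_int p / of_nat q\<bar> < 1 / real q powr t}"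
  have irr: "x \<notin> \<rat>" and inf: "infinite A" using x by (auto simp: W_def A_def)
  obtain e where e: "0 < e" "\<And>(p::int) (q::nat). 0 < q \<Longrightarrow> q \<le> N \<Longrightarrow> e \<le> \<bar>x - p / q\<bar>"
    using irrational_apart_from_small_denominators[OF irr, of N] by metis
  have small: "1 / real q powr t \<le> 1 / q" if "0 < q" for q :: nat
  proof -
    have "real q powr 1 \<le> real q powr t" using assms that by (intro powr_mono) auto
    then show ?thesis using that by (intro divide_left_mono) auto
  qed
  \<comment> \<open>An approximation with denominator \<open>q \<le> B\<close> has a bounded numerator, so infinitely many
      approximations need unbounded denominators.\<close>
  have "\<exists>p q. (p, q) \<in> A \<and> B < q" for B
  proof (rule ccontr)
    assume neg: "\<nexists>p q. (p, q) \<in> A \<and> B < q"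
    define D where "D = \<lceil>real B * \<bar>x\<bar> + 1\<rceil>"
    have "A \<subseteq> {-D..D} \<times> {..B}"
    proof
      fix z assume "z \<in> A"
      then obtain p q where z: "z = (p, q)" "q \<ge> 1" "\<bar>x - p / q\<bar> < 1 / real q powr t"
        by (auto simp: A_def)
      have "q \<le> B" using neg z \<open>z \<in> A\<close> by force
      have "\<bar>x - p / q\<bar> < 1 / q" using z(3) small[of q] z(2) by linarith
      then have "q * \<bar>x - p / q\<bar> < q * (1 / q)" using z(2) by (intro mult_strict_left_mono) auto
      then have "\<bar>q * x - p\<bar> < 1" using z(2) abs_denominator_mult[of q x p] by simp
      moreover have "\<bar>q * x\<bar> \<le> B * \<bar>x\<bar>"
        using \<open>q \<le> B\<close> by (simp add: abs_mult mult_right_mono)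
      ultimately have "\<bar>real_of_int p\<bar> \<le> real B * \<bar>x\<bar> + 1" by linarith
      then have "\<bar>p\<bar> \<le> D" unfolding D_def by linarith
      then show "z \<in> {-D..D} \<times> {..B}" using z \<open>q \<le> B\<close> by auto
    qed
    then show False using inf finite_subset by blast
  qed
  then obtain p q where pq: "(p, q) \<in> A" "nat \<lceil>1 / e\<rceil> < q" by blast
  then have q: "q \<ge> 1" and approx: "\<bar>x - p / q\<bar> < 1 / real q powr t" by (auto simp: A_def)
  have "1 / e < q" using pq(2) by linarith
  then have "1 / q < e" using e q by (simp add: field_simps)
  define g where "g = gcd p (int q)"
  have g: "0 < g" using q by (simp add: g_def)
  define p' q' where "p' = p div g" and "q' = nat (int q div g)"
  have pp: "p = p' * g" unfolding p'_def g_def by simp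
  have qq: "int q = int q' * g" unfolding q'_def g_def using q
    by (simp add: pos_imp_zdiv_nonneg_iff)
  have cop: "coprime p' (int q')"
  proof -
    have "coprime (p div gcd p (int q)) (int q div gcd p (int q))"
      using q by (intro div_gcd_coprime) auto
    moreover have "int q' = int q div g" unfolding q'_def using g
      by (simp add: pos_imp_zdiv_nonneg_iff)
    ultimately show ?thesis by (simp add: p'_def g_def)
  qed
  have q': "0 < q'" using qq q by (metis gr0I less_numeral_extra(3) mult_zero_left of_nat_0 of_nat_0_less_iff not_one_le_zero of_nat_eq_0_iff)
  have le: "q' \<le> q"
  proof -
    have "int q' * 1 \<le> int q' * g" using g by (intro mult_left_mono) auto
    then show ?thesis using qq by simp
  qed
  have frac: "p / real q = p' / real q'"
  proof -
    have "real q = real q' * of_int g" using arg_cong[OF qq, of real_of_int] by simp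
    then show ?thesis using g pp by simp
  qed
  show thesis
  proof
    show "coprime p' (int q')" by (rule cop)
    have "\<bar>x - p' / q'\<bar> < 1 / q" using approx small[of q] q frac by simp
    then show "N < q'" using e(2)[of q' p'] q' \<open>1 / q < e\<close> by linarith
    have "real q' powr t \<le> real q powr t" using le assms by (intro powr_mono2) auto
    then have "1 / real q powr t \<le> 1 / real q' powr t" using q' q by (intro divide_left_mono) auto
    then show "\<bar>x - p' / q'\<bar> < 1 / real q' powr t" using approx frac by simp
  qed
qed


section \<open>Separated points in orbits with two rotation steps\<close>

text \<open>A maximal set of pairwise unrelated points works: by maximality the neighbourhoods of its
  members cover \<open>V\<close>.\<close>

lemma separated_subset_of_bounded_neighbourhoods:
  assumes "finite V" and refl: "\<And>x. x \<in> V \<Longrightarrow> R x x" and sym: "\<And>x y. R x y \<Longrightarrow> R y x"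
    and D: "\<And>x. x \<in> V \<Longrightarrow> real (card {y \<in> V. R x y}) \<le> D"
  obtains S where "S \<subseteq> V" and "\<And>x y. x \<in> S \<Longrightarrow> y \<in> S \<Longrightarrow> x \<noteq> y \<Longrightarrow> \<not> R x y"
    and "real (card V) \<le> D * card S"
proof -
  define P where "P = {S. S \<subseteq> V \<and> (\<forall>x\<in>S. \<forall>y\<in>S. x \<noteq> y \<longrightarrow> \<not> R x y)}"
  have "finite P" "P \<noteq> {}" using \<open>finite V\<close> by (auto simp: P_def)
  then obtain S where S: "S \<in> P" and max: "\<And>T. T \<in> P \<Longrightarrow> S \<subseteq> T \<Longrightarrow> S = T"
    using finite_has_maximal by metis
  have "V \<subseteq> (\<Union>x\<in>S. {y \<in> V. R x y})"
  proof
    fix y assume y: "y \<in> V"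
    show "y \<in> (\<Union>x\<in>S. {y \<in> V. R x y})"
    proof (rule ccontr)
      assume no: "y \<notin> (\<Union>x\<in>S. {y \<in> V. R x y})"
      then have "insert y S \<in> P" using S y sym by (auto simp: P_def)
      then have "y \<in> S" using max[of "insert y S"] by blast
      then show False using no refl y by blast
    qed
  qed
  moreover have "finite S" using S \<open>finite V\<close> by (auto simp: P_def intro: finite_subset)
  ultimately have "card V \<le> card (\<Union>x\<in>S. {y \<in> V. R x y})"
    using \<open>finite V\<close> by (intro card_mono) auto
  also have "\<dots> \<le> (\<Sum>x\<in>S. card {y \<in> V. R x y})" using \<open>finite S\<close> by (rule card_UN_le)
  finally have "real (card V) \<le> (\<Sum>x\<in>S. real (card {y \<in> V. R x y}))" by (simp flip: of_nat_sum)
  also have "\<dots> \<le> real (card S) * D" using D S by (intro sum_bounded_above) (auto simp: P_def)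
  finally show thesis using that[of S] S by (auto simp: P_def mult.commute)
qed

text \<open>As \<open>u\<close> is invertible modulo \<open>s\<close>, distinct \<open>a < s\<close> give distinct residues of \<open>(a - c) * u\<close>;
  the hypothesis says that each of them has a representative in \<open>(- w, w)\<close>.\<close>

lemma card_near_multiples_le:
  assumes cop: "coprime u (int s)" and A: "A \<subseteq> {..<s}" and "0 \<le> w"
    and near: "\<And>a. a \<in> A \<Longrightarrow> \<exists>m::int. \<bar>real_of_int ((int a - c) * u - m * int s)\<bar> < w"
  shows "real (card A) \<le> 2 * w + 1"
proof -
  obtain m where m: "\<And>a. a \<in> A \<Longrightarrow> \<bar>real_of_int ((int a - c) * u - m a * int s)\<bar> < w"
    using near by metis
  define f where "f a = (int a - c) * u - m a * int s" for a
  have "inj_on f A"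
  proof (rule inj_onI)
    fix a b assume ab: "a \<in> A" "b \<in> A" "f a = f b"
    then have "(int a - int b) * u = (m a - m b) * int s" by (simp add: f_def algebra_simps)
    then have "int s dvd (int a - int b) * u" by simp
    then have "int s dvd int a - int b" using cop
      by (simp add: coprime_commute coprime_dvd_mult_left_iff)
    moreover have "\<bar>int a - int b\<bar> < int s"
    proof -
      have "a < s" "b < s" using ab A by auto
      then show ?thesis by linarith
    qed
    ultimately have "int a - int b = 0" by (metis abs_of_nat dvd_imp_le_int not_less)
    then show "a = b" by simp
  qed
  moreover have "f ` A \<subseteq> {-\<lfloor>w\<rfloor>..\<lfloor>w\<rfloor>}"
  proof
    fix z assume "z \<in> f ` A"
    then have "\<bar>real_of_int z\<bar> < w" using m by (auto simp: f_def)
    then have "z \<le> \<lfloor>w\<rfloor>" "- z \<le> \<lfloor>w\<rfloor>" by (simp_all add: le_floor_iff)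
    then show "z \<in> {-\<lfloor>w\<rfloor>..\<lfloor>w\<rfloor>}" by auto
  qed
  ultimately have "card A \<le> card {-\<lfloor>w\<rfloor>..\<lfloor>w\<rfloor>}" by (metis card_image card_mono finite_atLeastAtMost_int)
  also have "real \<dots> = 2 * of_int \<lfloor>w\<rfloor> + 1" using \<open>0 \<le> w\<close> by (simp add: algebra_simps)
  also have "\<dots> \<le> 2 * w + 1" by simp
  finally show ?thesis by simp
qed

text \<open>This is \<open>\<delta>\<close>-separation of the points \<open>x k\<close>, \<open>k \<in> S\<close>, on the circle of real numbers
  modulo 1.\<close>

definition separated_mod1 :: "real \<Rightarrow> (nat \<Rightarrow> real) \<Rightarrow> nat set \<Rightarrow> bool" where
  "separated_mod1 \<delta> x S \<longleftrightarrow>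
     (\<forall>k\<in>S. \<forall>l\<in>S. k \<noteq> l \<longrightarrow> (\<forall>m::int. \<delta> \<le> \<bar>x k - x l - m\<bar>))"

lemma alpha_beta_orbit_counts:
  fixes x :: "nat \<Rightarrow> real" and \<alpha> \<beta> :: real
  assumes "\<And>k. x (Suc k) = x k + \<alpha> \<or> x (Suc k) = x k + \<beta>"
  obtains a b :: "nat \<Rightarrow> nat"
  where "mono a" and "\<And>k. a k + b k = k" and "\<And>k. x k = x 0 + a k * \<alpha> + b k * \<beta>"
proof
  define c where "c k = (if x (Suc k) = x k + \<alpha> then 1 else 0 :: nat)" for k
  show "mono (\<lambda>k. \<Sum>j<k. c j)" by (auto intro!: monoI sum_mono2)
  show "(\<Sum>j<k. c j) + (\<Sum>j<k. 1 - c j) = k" for k by (induction k) (auto simp: c_def)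
  show "x k = x 0 + (\<Sum>j<k. c j) * \<alpha> + (\<Sum>j<k. 1 - c j) * \<beta>" for k
  proof (induction k)
    case (Suc k)
    then show ?case using assms[of k] by (auto simp: c_def algebra_simps)
  qed simp
qed

text \<open>In the situation studied here, \<open>p / q\<close> approximates \<open>\<beta>\<close> so well that, over the steps considered,
  replacing \<open>\<beta>\<close> by \<open>p / q\<close> moves no point by more than \<open>\<delta>\<close>.\<close>

context
  fixes x :: "nat \<Rightarrow> real" and a b :: "nat \<Rightarrow> nat" and \<alpha> \<beta> :: real
  assumes mono: "mono a" and steps: "\<And>k. a k + b k = k"
    and x: "\<And>k. x k = x 0 + a k * \<alpha> + b k * \<beta>"
begin

text \<open>Between two times with the same number of \<open>\<alpha>\<close>-steps, the orbit moves by a multiple of \<open>\<beta>\<close>,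
  hence by \<open>d * p / q\<close> up to \<open>\<delta>\<close>. For \<open>0 < d < q\<close> this is at least \<open>1 / q\<close> away from every
  integer.\<close>

lemma no_return_mod1:
  fixes l l' q :: nat and p m :: int and \<delta> \<rho> :: real
  assumes cop: "coprime p (int q)" and q: "0 < q"
    and appr: "l' * \<bar>\<beta> - p / q\<bar> \<le> \<delta>"
    and close: "\<bar>x l - x l' - m\<bar> < \<rho>" and \<rho>: "\<rho> + \<delta> \<le> 1 / q"
    and "l \<le> l'" "a l = a l'" "l' - l < q"
  shows "l = l'"
proof -
  define d where "d = l' - l"
  have "b l' = b l + d" unfolding d_def using steps[of l] steps[of l'] assms by linarith
  then have xd: "x l - x l' = - (d * \<beta>)" using x[of l] x[of l'] assms by (simp add: algebra_simps)
  have "d * \<bar>\<beta> - p / q\<bar> \<le> l' * \<bar>\<beta> - p / q\<bar>" unfolding d_def by (intro mult_right_mono) auto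
  then have "\<bar>d * \<beta> - d * (p / q)\<bar> \<le> \<delta>" using appr
    by (simp only: abs_mult abs_of_nat flip: right_diff_distrib)
  then have lt: "\<bar>d * (p / q) + m\<bar> < 1 / q" using close \<rho> unfolding xd by linarith
  have "real_of_int (int d * p + m * int q) = q * (d * (p / q) + m)"
    using q by (simp add: field_simps)
  then have "\<bar>real_of_int (int d * p + m * int q)\<bar> = q * \<bar>d * (p / q) + m\<bar>" by (simp add: abs_mult)
  also have "\<dots> < q * (1 / q)" using lt q by (intro mult_strict_left_mono) auto
  finally have "real_of_int \<bar>int d * p + m * int q\<bar> < of_int 1" using q by simp
  then have "int d * p + m * int q = 0" by (simp only: of_int_less_iff)
  then have "int d * p = (- m) * int q" by simp
  then have "int q dvd int d * p" by simp
  then have "int q dvd int d" using cop by (simp add: coprime_commute coprime_dvd_mult_left_iff)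
  then have "q dvd d" by simp
  then have "d = 0" using assms(8) unfolding d_def using nat_dvd_not_less by blast
  then show ?thesis using assms by (simp add: d_def)
qed

text \<open>Suppose that \<open>x k\<close> and \<open>x l\<close> are \<open>\<delta>\<close>-close modulo 1. Multiplication by \<open>q\<close> almost eliminates
  the \<open>\<beta>\<close>-steps, and \<open>q * \<alpha>\<close> is nearly \<open>u / s\<close>. So \<open>(a l - a k) * u / s\<close> is within \<open>3 * q * \<delta>\<close> of
  an integer, which leaves at most \<open>7 * q * s * \<delta>\<close> values for \<open>a l\<close>. When no \<open>q\<close> consecutive
  \<open>\<beta>\<close>-steps occur, \<open>a l\<close> and the position near \<open>x k\<close> determine \<open>l\<close>. Every time thus has few close
  times among the first \<open>s\<close>, and a large separated subset exists.\<close>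

lemma separated_times_without_long_run:
  fixes s q :: nat and p u :: int and \<delta> :: real
  assumes cop: "coprime p (int q)" and q: "0 < q" and appr: "s * \<bar>\<beta> - p / q\<bar> \<le> \<delta>"
    and cop': "coprime u (int s)" and s: "0 < s" and appr': "\<bar>s * (q * \<alpha>) - u\<bar> \<le> 1 / s"
    and \<delta>: "1 / (q * s) \<le> \<delta>" "3 * \<delta> \<le> 1 / q"
    and no_run: "\<And>k l. k \<le> l \<Longrightarrow> l < s \<Longrightarrow> a k = a l \<Longrightarrow> l - k < q"
  obtains S where "finite S" and "separated_mod1 \<delta> x S" and "1 / (7 * q * \<delta>) \<le> card S"
proof -
  define R where "R k l \<longleftrightarrow> (\<exists>m::int. \<bar>x k - x l - m\<bar> < \<delta>)" for k l
  have "0 < 1 / (q * s)" using q s by simp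
  then have \<delta>0: "0 < \<delta>" using \<delta> by linarith
  have big: "1 \<le> q * s * \<delta>" using \<delta>(1) q s by (simp add: field_simps)
  have sym: "R l k" if "R k l" for k l
  proof -
    obtain m :: int where "\<bar>x k - x l - m\<bar> < \<delta>" using \<open>R k l\<close> by (auto simp: R_def)
    then have "\<bar>x l - x k - of_int (- m)\<bar> < \<delta>" by simp
    then show ?thesis unfolding R_def by blast
  qed
  have few: "real (card {l \<in> {..<s}. R k l}) \<le> 7 * q * s * \<delta>" if k: "k \<in> {..<s}" for k
  proof -
    define N where "N = {l \<in> {..<s}. R k l}"
    have eq: "l = l'" if ll: "l \<in> N" "l' \<in> N" "a l = a l'" "l \<le> l'" for l l'
    proof -
      obtain m m' :: int where "\<bar>x k - x l - m\<bar> < \<delta>" "\<bar>x k - x l' - m'\<bar> < \<delta>"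
        using ll by (auto simp: N_def R_def)
      then have "\<bar>x l - x l' - of_int (m' - m)\<bar> < 2 * \<delta>" by simp
      moreover have "l' * \<bar>\<beta> - p / q\<bar> \<le> s * \<bar>\<beta> - p / q\<bar>"
        using ll by (intro mult_right_mono) (auto simp: N_def)
      then have "l' * \<bar>\<beta> - p / q\<bar> \<le> \<delta>" using appr by linarith
      moreover have "l' - l < q" using no_run[of l l'] ll by (auto simp: N_def)
      ultimately show ?thesis using no_return_mod1[OF cop q, of l' \<delta> l "m' - m" "2 * \<delta>"] \<delta>(2) ll by simp
    qed
    have inj: "inj_on a N"
    proof (rule inj_onI)
      fix l l' assume "l \<in> N" "l' \<in> N" "a l = a l'"
      then show "l = l'" using eq[of l l'] eq[of l' l] by (cases "l \<le> l'") auto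
    qed
    have "real (card (a ` N)) \<le> 2 * (3 * q * s * \<delta>) + 1"
    proof (rule card_near_multiples_le[OF cop'])
      show "a ` N \<subseteq> {..<s}"
      proof
        fix z assume "z \<in> a ` N"
        then obtain l where "l < s" "z = a l" by (auto simp: N_def)
        then show "z \<in> {..<s}" using steps[of l] by simp
      qed
      show "0 \<le> 3 * q * s * \<delta>" using \<delta>0 by simp
      fix z assume "z \<in> a ` N"
      then obtain l where l: "l < s" "R k l" "z = a l" by (auto simp: N_def)
      then obtain m :: int where "\<bar>x k - x l - m\<bar> < \<delta>" by (auto simp: R_def)
      \<comment> \<open>Below, \<open>q * s * X\<close> is the separation in question, and the integer to be bounded differs from
          it by the two approximation errors, for \<open>\<beta>\<close> and for \<open>q * \<alpha>\<close>.\<close>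
      define da db where "da = int (a l) - int (a k)" and "db = int (b l) - int (b k)"
      define X where "X = da * \<alpha> + db * \<beta> + m"
      have "x k - x l - m = - X" unfolding X_def da_def db_def x[of k] x[of l] by (simp add: algebra_simps)
      then have X: "\<bar>X\<bar> \<le> \<delta>" "\<bar>X\<bar> < \<delta>" using \<open>\<bar>x k - x l - m\<bar> < \<delta>\<close> by simp_all
      have da: "\<bar>da\<bar> \<le> int s" and db: "\<bar>db\<bar> \<le> int s"
        using l k steps[of l] steps[of k] unfolding da_def db_def by auto
      have "\<bar>real_of_int db * (\<beta> - p / q)\<bar> = real_of_int \<bar>db\<bar> * \<bar>\<beta> - p / q\<bar>" by (simp add: abs_mult)
      also have "\<dots> \<le> real_of_int (int s) * \<bar>\<beta> - p / q\<bar>" using db by (intro mult_right_mono) (simp_all only: of_int_le_iff abs_ge_zero)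
      finally have B: "\<bar>real_of_int db * (\<beta> - p / q)\<bar> \<le> \<delta>" using appr by simp
      have "\<bar>real_of_int da * (s * (q * \<alpha>) - u)\<bar> = real_of_int \<bar>da\<bar> * \<bar>s * (q * \<alpha>) - u\<bar>" by (simp add: abs_mult)
      also have "\<dots> \<le> real_of_int (int s) * (1 / s)" using da appr'
        by (intro mult_mono) (simp_all only: of_int_le_iff abs_ge_zero of_int_0_le_iff of_nat_0_le_iff)
      finally have C: "\<bar>real_of_int da * (s * (q * \<alpha>) - u)\<bar> \<le> q * s * \<delta>" using big s by simp
      have AB: "\<bar>q * s * (X - real_of_int db * (\<beta> - p / q))\<bar> < q * s * (\<delta> + \<delta>)"
      proof -
        have "\<bar>X - real_of_int db * (\<beta> - p / q)\<bar> < \<delta> + \<delta>" using X B by linarith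
        then have "q * s * \<bar>X - real_of_int db * (\<beta> - p / q)\<bar> < q * s * (\<delta> + \<delta>)"
          using q s by (intro mult_strict_left_mono) auto
        then show ?thesis by (simp add: abs_mult)
      qed
      have "real_of_int ((int z - int (a k)) * u - (- (m * int q + db * p)) * int s)
          = q * s * (X - real_of_int db * (\<beta> - p / q)) - real_of_int da * (s * (q * \<alpha>) - u)"
        unfolding X_def l(3) da_def[symmetric] using q by (simp add: field_simps)
      moreover have "\<bar>q * s * (X - real_of_int db * (\<beta> - p / q)) - real_of_int da * (s * (q * \<alpha>) - u)\<bar>
         < q * s * (\<delta> + \<delta>) + q * s * \<delta>" using AB C by linarith
      ultimately have "\<bar>real_of_int ((int z - int (a k)) * u - (- (m * int q + db * p)) * int s)\<bar>
          < 3 * q * s * \<delta>" by (simp add: algebra_simps)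
      then show "\<exists>m::int. \<bar>real_of_int ((int z - int (a k)) * u - m * int s)\<bar> < 3 * q * s * \<delta>" by blast
    qed
    also have "\<dots> \<le> 2 * (3 * q * s * \<delta>) + q * s * \<delta>" using big by (rule add_left_mono)
    also have "\<dots> = 7 * q * s * \<delta>" by simp
    finally show ?thesis using card_image[OF inj] by (simp add: N_def)
  qed
  obtain S where S: "S \<subseteq> {..<s}" "\<And>k l. k \<in> S \<Longrightarrow> l \<in> S \<Longrightarrow> k \<noteq> l \<Longrightarrow> \<not> R k l"
    "real (card {..<s}) \<le> (7 * q * s * \<delta>) * card S"
  proof (rule separated_subset_of_bounded_neighbourhoods[of "{..<s}" R])
    show "R k k" for k using \<delta>0 by (auto simp: R_def intro: exI[of _ 0])
  qed (use few sym in blast)+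
  show thesis
  proof
    show "finite S" using S(1) finite_subset by blast
    show "separated_mod1 \<delta> x S" using S(2) by (force simp: separated_mod1_def R_def not_less)
    have "s * 1 \<le> s * (7 * q * \<delta> * card S)" using S(3) by (simp add: algebra_simps)
    then have "1 \<le> 7 * q * \<delta> * card S" using s by simp
    then show "1 / (7 * q * \<delta>) \<le> card S" using q \<delta>0 by (simp add: field_simps)
  qed
qed

text \<open>Along \<open>q\<close> consecutive \<open>\<beta>\<close>-steps the orbit nearly visits a translate of all multiples of
  \<open>1 / q\<close>.\<close>

lemma separated_times_of_long_run:
  fixes s q :: nat and p :: int
  assumes cop: "coprime p (int q)" and q: "0 < q" and appr: "s * \<bar>\<beta> - p / q\<bar> \<le> 1 / (2 * q)"
    and run: "k \<le> l" "l < s" "a k = a l" "q \<le> l - k"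
  shows "separated_mod1 (1 / (2 * q)) x {k..<k + q}"
proof -
  have const: "a i = a k" if "i \<in> {k..<k + q}" for i
  proof -
    have "k \<le> i" "i \<le> l" using that run by auto
    then have "a k \<le> a i" "a i \<le> a l" using monoD[OF mono] by blast+
    then show ?thesis using run by simp
  qed
  have main: "1 / (2 * q) \<le> \<bar>x i - x j - m\<bar>" if ij: "i \<in> {k..<k + q}" "j \<in> {k..<k + q}" "i < j" for i j and m :: int
  proof (rule ccontr)
    assume "\<not> 1 / (2 * q) \<le> \<bar>x i - x j - m\<bar>"
    moreover have "j * \<bar>\<beta> - p / q\<bar> \<le> s * \<bar>\<beta> - p / q\<bar>"
      using ij run by (intro mult_right_mono) auto
    then have "j * \<bar>\<beta> - p / q\<bar> \<le> 1 / (2 * q)" using appr by linarith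
    moreover have "j - i < q" using ij by auto
    ultimately have "i = j"
      using no_return_mod1[OF cop q, of j "1 / (2 * q)" i m "1 / (2 * q)"] const[of i] const[of j] ij by simp
    then show False using ij by simp
  qed
  show ?thesis unfolding separated_mod1_def
  proof (intro ballI impI allI)
    fix i j and m :: int assume ij: "i \<in> {k..<k + q}" "j \<in> {k..<k + q}" "i \<noteq> j"
    show "1 / (2 * q) \<le> \<bar>x i - x j - m\<bar>"
    proof (cases "i < j")
      case True
      then show ?thesis using main ij by blast
    next
      case False
      then have "1 / (2 * q) \<le> \<bar>x j - x i - of_int (- m)\<bar>" using main[of j i "- m"] ij by simp
      then show ?thesis by simp
    qed
  qed
qed

end

lemma eventually_powr_less_1:
  fixes C \<mu> :: real
  assumes "0 < \<mu>"
  shows "eventually (\<lambda>q::nat. C * real q powr (- \<mu>) < 1) at_top"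
proof -
  have "((\<lambda>q::nat. C * real q powr (- \<mu>)) \<longlongrightarrow> C * 0) at_top"
    using assms by (intro tendsto_mult tendsto_const tendsto_neg_powr filterlim_real_sequentially) auto
  then show ?thesis by (intro order_tendstoD(2)) auto
qed

text \<open>Every orbit of steps \<open>\<alpha>\<close> and \<open>\<beta>\<close>, in whatever order, has upper box dimension at least
  \<open>1 - 2 * (\<tau>\<^sub>1 - 1) / \<tau>\<^sub>2\<close> on the circle, in the following form.

  Take a reduced fraction \<open>p / q\<close> with \<open>\<bar>\<beta> - p / q\<bar> < q powr (- \<tau>\<^sub>2)\<close>, and by Dirichlet's theorem a
  reduced fraction \<open>h / s\<close> with \<open>s \<le> q powr (\<tau>\<^sub>2 / 2)\<close> and
  \<open>\<bar>s * q * \<alpha> - h\<bar> < q powr (- \<tau>\<^sub>2 / 2)\<close>, up to rounding. In \<open>s\<close> steps the first approximation costs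
  at most \<open>s * q powr (- \<tau>\<^sub>2) \<le> q powr (- \<tau>\<^sub>2 / 2)\<close>. The order of \<open>\<alpha>\<close> prevents \<open>s * q\<close> from being
  small: for \<open>\<tau>\<close> slightly above \<open>\<tau>\<^sub>1\<close>, \<open>1 / (s * q)\<close> is at most a constant times \<open>q powr (- \<gamma>)\<close> with
  \<open>\<gamma> = \<tau>\<^sub>2 / (2 * (\<tau> - 1))\<close>. Hence \<open>\<delta> = B * q powr (- \<gamma>)\<close> dominates both errors, and the number of
  separated points is of order \<open>1 / (q * \<delta>)\<close>, that is \<open>\<delta> powr (- (1 - 1 / \<gamma>))\<close>. A long run of
  \<open>\<beta>\<close>-steps gives even \<open>q\<close> points at scale \<open>1 / (2 * q)\<close>.\<close>

theorem alpha_beta_orbit_separated_subset: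
  fixes \<alpha> \<beta> \<tau>\<^sub>1 \<tau>\<^sub>2 v C :: real and x :: "nat \<Rightarrow> real"
  assumes \<alpha>: "\<alpha> \<in> exact_order_set (ereal \<tau>\<^sub>1)" and \<beta>: "\<beta> \<in> W \<tau>\<^sub>2" and \<tau>: "2 \<le> \<tau>\<^sub>1"
    and v: "0 \<le> v" "v < 1 - 2 * (\<tau>\<^sub>1 - 1) / \<tau>\<^sub>2" and "0 < \<tau>\<^sub>2"
    and orbit: "\<And>k. x (Suc k) = x k + \<alpha> \<or> x (Suc k) = x k + \<beta>"
  obtains \<delta> S where "0 < \<delta>" and "\<delta> \<le> 1" and "finite S" and "separated_mod1 \<delta> x S"
    and "C * \<delta> powr (- v) < card S"
proof -
  obtain a b :: "nat \<Rightarrow> nat" where ab: "mono a" "\<And>k. a k + b k = k" "\<And>k. x k = x 0 + a k * \<alpha> + b k * \<beta>"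
    by (rule alpha_beta_orbit_counts[of x \<alpha> \<beta>, OF orbit]) blast
  have gap: "2 * (\<tau>\<^sub>1 - 1) < \<tau>\<^sub>2 * (1 - v)" using v(2) \<open>0 < \<tau>\<^sub>2\<close> by (simp add: field_simps)
  have v1: "v < 1" using v(2) \<tau> \<open>0 < \<tau>\<^sub>2\<close> by (smt (verit) divide_nonneg_pos)
  \<comment> \<open>The exponent \<open>\<tau>\<close> exceeds \<open>\<tau>\<^sub>1\<close>, yet so little that \<open>\<gamma> * (1 - v) > 1\<close> below.\<close>
  define \<tau> where "\<tau> = 1 + (2 * (\<tau>\<^sub>1 - 1) + \<tau>\<^sub>2 * (1 - v)) / 4"
  have \<tau>_props: "\<tau>\<^sub>1 < \<tau>" "2 * (\<tau> - 1) < \<tau>\<^sub>2 * (1 - v)" "1 < \<tau> - 1" using gap \<tau> by (simp_all add: \<tau>_def field_simps)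
  define \<gamma> where "\<gamma> = \<tau>\<^sub>2 / (2 * (\<tau> - 1))"
  have \<gamma>: "1 < \<gamma> * (1 - v)" using \<tau>_props by (simp add: \<gamma>_def field_simps)
  have "\<gamma> * (1 - v) \<le> \<gamma> * 1" using \<tau>_props \<open>0 < \<tau>\<^sub>2\<close> v by (intro mult_left_mono) (auto simp: \<gamma>_def)
  then have \<gamma>1: "1 < \<gamma>" using \<gamma> by simp
  have \<gamma>le: "\<gamma> \<le> \<tau>\<^sub>2 / 2" unfolding \<gamma>_def using \<tau>_props \<open>0 < \<tau>\<^sub>2\<close> by (intro divide_left_mono) auto
  obtain c where c: "0 < c" "\<And>(p::int) (q::nat). 0 < q \<Longrightarrow> c * real q powr (1 - \<tau>) \<le> \<bar>q * \<alpha> - p\<bar>"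
    by (rule diophantine_of_exact_order[OF \<alpha> \<tau> \<tau>_props(1)]) blast
  \<comment> \<open>\<open>B\<close> collects the constant from the order of \<open>\<alpha>\<close>; the conditions on large \<open>q\<close> are, after \<open>1 \<le> q\<close>,
      enough points in the case of a long run, \<open>3 * \<delta> \<le> 1 / q\<close>, enough points otherwise, and
      accuracy of \<open>p / q\<close> at scale \<open>1 / (2 * q)\<close>.\<close>
  define B where "B = max 1 ((c / 2) powr (- 1 / (\<tau> - 1)))"
  have B: "0 < B" "1 \<le> B" "(c / 2) powr (- 1 / (\<tau> - 1)) \<le> B" by (auto simp: B_def)
  have "eventually (\<lambda>q::nat. 1 \<le> real q) at_top" using eventually_ge_at_top[of 1] by eventually_elim simp
  moreover have "eventually (\<lambda>q::nat. C * 2 powr v * real q powr (- (1 - v)) < 1) at_top"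
    using v1 by (intro eventually_powr_less_1) simp
  moreover have "eventually (\<lambda>q::nat. 3 * B * real q powr (- (\<gamma> - 1)) < 1) at_top"
    using \<gamma>1 by (intro eventually_powr_less_1) simp
  moreover have "eventually (\<lambda>q::nat. 7 * C * B powr (1 - v) * real q powr (- (\<gamma> * (1 - v) - 1)) < 1) at_top"
    using \<gamma> by (intro eventually_powr_less_1) simp
  moreover have "eventually (\<lambda>q::nat. 2 * real q powr (- (\<tau>\<^sub>2 / 2 - 1)) < 1) at_top"
    using \<gamma>1 \<gamma>le by (intro eventually_powr_less_1) simp
  ultimately have "eventually (\<lambda>q::nat. 1 \<le> real q \<and> C * 2 powr v * real q powr (- (1 - v)) < 1 \<and>
     3 * B * real q powr (- (\<gamma> - 1)) < 1 \<and>
     7 * C * B powr (1 - v) * real q powr (- (\<gamma> * (1 - v) - 1)) < 1 \<and>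
     2 * real q powr (- (\<tau>\<^sub>2 / 2 - 1)) < 1) at_top"
    by eventually_elim simp
  then obtain N where N: "\<And>q::nat. q \<ge> N \<Longrightarrow> 1 \<le> real q \<and> C * 2 powr v * real q powr (- (1 - v)) < 1 \<and>
     3 * B * real q powr (- (\<gamma> - 1)) < 1 \<and>
     7 * C * B powr (1 - v) * real q powr (- (\<gamma> * (1 - v) - 1)) < 1 \<and>
     2 * real q powr (- (\<tau>\<^sub>2 / 2 - 1)) < 1"
    unfolding eventually_sequentially by blast
  have "1 \<le> \<tau>\<^sub>2" using \<gamma>1 \<gamma>le by simp
  obtain p :: int and q :: nat where cop: "coprime p (int q)" and "N < q" and pq: "\<bar>\<beta> - p / q\<bar> < 1 / real q powr \<tau>\<^sub>2"
    by (rule large_reduced_approximation[OF \<beta> \<open>1 \<le> \<tau>\<^sub>2\<close>, of N]) blast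
  have q: "0 < q" "1 \<le> real q" and q1: "C * 2 powr v * real q powr (- (1 - v)) < 1"
    and q2: "3 * B * real q powr (- (\<gamma> - 1)) < 1"
    and q3: "7 * C * B powr (1 - v) * real q powr (- (\<gamma> * (1 - v) - 1)) < 1"
    and q4: "2 * real q powr (- (\<tau>\<^sub>2 / 2 - 1)) < 1"
    using N[of q] \<open>N < q\<close> by auto
  define M where "M = nat \<lfloor>real q powr (\<tau>\<^sub>2 / 2)\<rfloor>"
  have qp: "1 \<le> real q powr (\<tau>\<^sub>2 / 2)" using q \<open>0 < \<tau>\<^sub>2\<close> by (intro ge_one_powr_ge_zero) auto
  have "0 < M" using qp by (simp add: M_def)
  moreover have "real M = of_int \<lfloor>real q powr (\<tau>\<^sub>2 / 2)\<rfloor>" using qp by (simp add: M_def)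
  ultimately have M: "0 < M" "M \<le> real q powr (\<tau>\<^sub>2 / 2)" "real q powr (\<tau>\<^sub>2 / 2) / 2 \<le> M"
    by linarith+
  obtain h k where hk: "coprime h k" "0 < k" "k \<le> int M" "\<bar>of_int k * (q * \<alpha>) - of_int h\<bar> < 1 / M"
    by (rule Dirichlet_approx_coprime[OF M(1)]) blast
  define s where "s = nat k"
  have s: "0 < s" "s \<le> M" "coprime h (int s)" "\<bar>s * (q * \<alpha>) - of_int h\<bar> < 1 / M"
    using hk by (simp_all add: s_def)
  have "s * \<bar>\<beta> - p / q\<bar> \<le> real q powr (\<tau>\<^sub>2 / 2) * (1 / real q powr \<tau>\<^sub>2)"
    using s M pq by (intro mult_mono) auto
  also have "\<dots> = real q powr (- (\<tau>\<^sub>2 / 2))" using q by (simp add: powr_minus_divide flip: powr_diff)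
  finally have s_err: "s * \<bar>\<beta> - p / q\<bar> \<le> real q powr (- (\<tau>\<^sub>2 / 2))" .
  show thesis
  proof (cases "\<exists>k l. k \<le> l \<and> l < s \<and> a k = a l \<and> q \<le> l - k")
    case True
    then obtain k l where kl: "k \<le> l" "l < s" "a k = a l" "q \<le> l - k" by blast
    have "2 * q * real q powr (- (\<tau>\<^sub>2 / 2)) = 2 * real q powr (- (\<tau>\<^sub>2 / 2 - 1))"
      using q by (simp add: powr_diff powr_minus_divide)
    then have "2 * q * real q powr (- (\<tau>\<^sub>2 / 2)) \<le> 1" using q4 by simp
    then have "real q powr (- (\<tau>\<^sub>2 / 2)) \<le> 1 / (2 * q)" using q by (simp add: field_simps)
    then have "s * \<bar>\<beta> - p / q\<bar> \<le> 1 / (2 * q)" using s_err by linarith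
    then have sep: "separated_mod1 (1 / (2 * q)) x {k..<k + q}"
      using separated_times_of_long_run[OF ab cop q(1) _ kl] by simp
    show thesis
    proof (rule that)
      show "0 < 1 / real (2 * q)" "1 / real (2 * q) \<le> 1" using q by auto
      have "C * (1 / real (2 * q)) powr (- v) = q * (C * 2 powr v * real q powr (- (1 - v)))"
        using q by (simp add: powr_minus_divide powr_mult powr_divide powr_diff)
      also have "\<dots> < real q * 1" using q1 q by (intro mult_strict_left_mono) auto
      finally show "C * (1 / real (2 * q)) powr (- v) < card {k..<k + q}" by simp
    qed (use sep in auto)
  next
    case False
    then have no_run: "l - k < q" if "k \<le> l" "l < s" "a k = a l" for k l using that by force
    define \<delta> where "\<delta> = B * real q powr (- \<gamma>)"
    have \<delta>0: "0 < \<delta>" using B q by (simp add: \<delta>_def)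
    have "real q powr (- (\<tau>\<^sub>2 / 2)) \<le> real q powr (- \<gamma>)" using \<gamma>le q by (intro powr_mono) auto
    also have "\<dots> \<le> \<delta>" unfolding \<delta>_def using B q by simp
    finally have err: "s * \<bar>\<beta> - p / q\<bar> \<le> \<delta>" using s_err by linarith
    have "1 / M \<le> 1 / s" using s by (intro divide_left_mono) auto
    then have err': "\<bar>s * (q * \<alpha>) - of_int h\<bar> \<le> 1 / s" using s by linarith
    have "3 * \<delta> * q = 3 * B * real q powr (- (\<gamma> - 1))"
      using q by (simp add: \<delta>_def powr_diff powr_minus_divide)
    then have \<delta>small: "3 * \<delta> \<le> 1 / q" using q2 q by (simp add: field_simps)
    have lower: "1 / (q * s) \<le> \<delta>"
    proof -
      \<comment> \<open>Compare the upper bound from Dirichlet's theorem with the lower bound from the order of \<open>\<alpha>\<close>,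
          for the denominator \<open>X = s * q\<close>.\<close>
      define X where "X = real (s * q)"
      have X: "0 < X" using q s by (simp add: X_def)
      have "c * X powr (1 - \<tau>) \<le> \<bar>(s * q) * \<alpha> - h\<bar>"
        using c(2)[of "s * q" h] q s unfolding X_def by simp
      also have "\<dots> \<le> 1 / M" using s(4) by (simp add: mult.assoc)
      also have "\<dots> \<le> 1 / (real q powr (\<tau>\<^sub>2 / 2) / 2)" using M qp q(1) by (intro divide_left_mono mult_pos_pos) auto
      finally have "c * X powr (1 - \<tau>) \<le> 2 * real q powr (- (\<tau>\<^sub>2 / 2))" by (simp add: powr_minus_divide)
      then have "X powr (1 - \<tau>) \<le> 2 / c * real q powr (- (\<tau>\<^sub>2 / 2))"
        using c(1) by (simp add: pos_le_divide_eq mult.commute)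
      moreover have "(1 / X) powr (\<tau> - 1) = X powr (1 - \<tau>)"
        using X by (simp add: powr_divide flip: powr_minus_divide)
      moreover have "(c / 2) powr (- 1) = 2 / c" using c(1) by (simp add: powr_minus_divide)
      ultimately have "(1 / X) powr (\<tau> - 1) \<le> (c / 2) powr (- 1) * real q powr (- (\<tau>\<^sub>2 / 2))"
        by simp
      then have "((1 / X) powr (\<tau> - 1)) powr (1 / (\<tau> - 1)) \<le> ((c / 2) powr (- 1) * real q powr (- (\<tau>\<^sub>2 / 2))) powr (1 / (\<tau> - 1))"
        using \<tau>_props by (intro powr_mono2) auto
      moreover have "((1 / X) powr (\<tau> - 1)) powr (1 / (\<tau> - 1)) = 1 / X"
        using \<tau>_props X by (simp add: powr_powr)
      moreover have "((c / 2) powr (- 1) * real q powr (- (\<tau>\<^sub>2 / 2))) powr (1 / (\<tau> - 1))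
        = (c / 2) powr (- 1 / (\<tau> - 1)) * real q powr (- \<gamma>)"
      proof -
        have "((c / 2) powr (- 1) * real q powr (- (\<tau>\<^sub>2 / 2))) powr (1 / (\<tau> - 1))
          = (c / 2) powr ((- 1) * (1 / (\<tau> - 1))) * real q powr (- (\<tau>\<^sub>2 / 2) * (1 / (\<tau> - 1)))"
          using c(1) q by (simp only: powr_mult powr_powr)
        moreover have "- (\<tau>\<^sub>2 / 2) * (1 / (\<tau> - 1)) = - \<gamma>" by (simp add: \<gamma>_def)
        ultimately show ?thesis by simp
      qed
      ultimately have "1 / X \<le> (c / 2) powr (- 1 / (\<tau> - 1)) * real q powr (- \<gamma>)" by simp
      also have "\<dots> \<le> \<delta>" unfolding \<delta>_def using B by (intro mult_right_mono) auto
      finally show ?thesis by (simp add: X_def mult.commute)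
    qed
    obtain S where S: "finite S" "separated_mod1 \<delta> x S" "1 / (7 * q * \<delta>) \<le> card S"
      by (rule separated_times_without_long_run[OF ab cop q(1) err s(3,1) err' lower \<delta>small no_run])
    show thesis
    proof (rule that[OF \<delta>0 _ S(1,2)])
      have "1 / real q \<le> 1" using q by simp
      then show "\<delta> \<le> 1" using \<delta>small \<delta>0 by linarith
      have "7 * q * \<delta> * (C * \<delta> powr (- v)) = 7 * C * q * (\<delta> powr (1 - v))"
        using \<delta>0 by (simp add: powr_diff powr_minus_divide)
      also have "\<delta> powr (1 - v) = B powr (1 - v) * real q powr (- \<gamma> * (1 - v))"
        unfolding \<delta>_def using B q by (simp add: powr_mult powr_powr)
      also have "7 * C * q * (B powr (1 - v) * real q powr (- \<gamma> * (1 - v)))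
          = 7 * C * B powr (1 - v) * real q powr (- (\<gamma> * (1 - v) - 1))"
        using q by (simp add: powr_diff powr_minus_divide)
      also have "\<dots> < 1" by (rule q3)
      finally have "7 * q * \<delta> * (C * \<delta> powr (- v)) < 1" .
      then have "C * \<delta> powr (- v) < 1 / (7 * q * \<delta>)" using q \<delta>0 by (simp add: field_simps)
      then show "C * \<delta> powr (- v) < card S" using S(3) by simp
    qed
  qed
qed


section \<open>Self-similar sets with separated pieces\<close>

primrec cylinder_map :: "('i \<Rightarrow> 'a \<Rightarrow> 'a) \<Rightarrow> (nat \<Rightarrow> 'i) \<Rightarrow> nat \<Rightarrow> 'a \<Rightarrow> 'a" where
  "cylinder_map \<phi> \<omega> 0 = id"
| "cylinder_map \<phi> \<omega> (Suc k) = cylinder_map \<phi> \<omega> k \<circ> \<phi> (\<omega> k)"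

text \<open>A self-similar set with disjoint first-level pieces, seen metrically: zooming into it involves
  only distances and contraction ratios, not the orthogonal parts of the maps.\<close>

locale separated_self_similar =
  fixes I :: "'i set" and \<phi> :: "'i \<Rightarrow> 'a \<Rightarrow> 'a :: heine_borel" and r :: "'i \<Rightarrow> real" and E :: "'a set"
  assumes finite_I: "finite I" and compact_E: "compact E" and E_nonempty: "E \<noteq> {}"
    and E_eq: "E = (\<Union>i\<in>I. \<phi> i ` E)"
    and dist_\<phi>: "i \<in> I \<Longrightarrow> dist (\<phi> i x) (\<phi> i y) = r i * dist x y"
    and r_pos: "i \<in> I \<Longrightarrow> 0 < r i" and r_less_1: "i \<in> I \<Longrightarrow> r i < 1"
    and disjoint_pieces: "i \<in> I \<Longrightarrow> j \<in> I \<Longrightarrow> i \<noteq> j \<Longrightarrow> \<phi> i ` E \<inter> \<phi> j ` E = {}"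
begin

lemma compact_piece: "i \<in> I \<Longrightarrow> compact (\<phi> i ` E)"
proof (rule compact_continuous_image[OF _ compact_E])
  assume "i \<in> I"
  then have "(r i)-lipschitz_on E (\<phi> i)"
    using dist_\<phi> r_pos by (intro lipschitz_onI) (auto simp: less_imp_le)
  then show "continuous_on E (\<phi> i)" by (rule lipschitz_on_continuous_on)
qed

lemma ex_gap: "\<exists>\<kappa>>0. \<forall>i\<in>I. \<forall>j\<in>I. i \<noteq> j \<longrightarrow> (\<forall>x\<in>E. \<forall>y\<in>E. \<kappa> \<le> dist (\<phi> i x) (\<phi> j y))"
proof -
  define P where "P = {(i, j). i \<in> I \<and> j \<in> I \<and> i \<noteq> j}"
  have "finite P" by (rule finite_subset[of _ "I \<times> I"]) (auto simp: P_def finite_I)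
  have "\<exists>d>0. \<forall>x\<in>E. \<forall>y\<in>E. d \<le> dist (\<phi> (fst p) x) (\<phi> (snd p) y)" if "p \<in> P" for p
  proof -
    have "\<exists>d>0. \<forall>x\<in>\<phi> (fst p) ` E. \<forall>y\<in>\<phi> (snd p) ` E. d \<le> dist x y"
      using that compact_piece compact_imp_closed[OF compact_piece] disjoint_pieces
      by (intro separate_compact_closed) (simp_all add: P_def case_prod_unfold)
    then show ?thesis by blast
  qed
  then obtain d where d: "\<And>p. p \<in> P \<Longrightarrow> 0 < d p"
      "\<And>p x y. p \<in> P \<Longrightarrow> x \<in> E \<Longrightarrow> y \<in> E \<Longrightarrow> d p \<le> dist (\<phi> (fst p) x) (\<phi> (snd p) y)"
    by metis
  define \<kappa> where "\<kappa> = Min (insert 1 (d ` P))"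
  have "0 < \<kappa>" using d \<open>finite P\<close> by (auto simp: \<kappa>_def)
  moreover have "\<kappa> \<le> dist (\<phi> i x) (\<phi> j y)" if "i \<in> I" "j \<in> I" "i \<noteq> j" "x \<in> E" "y \<in> E" for i j x y
  proof -
    have "\<kappa> \<le> d (i, j)" unfolding \<kappa>_def using \<open>finite P\<close> that by (intro Min_le) (auto simp: P_def)
    also have "\<dots> \<le> dist (\<phi> i x) (\<phi> j y)" using d(2)[of "(i, j)"] that by (simp add: P_def)
    finally show ?thesis .
  qed
  ultimately show ?thesis by blast
qed

definition gap :: real where
  "gap = (SOME \<kappa>. \<kappa> > 0 \<and> (\<forall>i\<in>I. \<forall>j\<in>I. i \<noteq> j \<longrightarrow> (\<forall>x\<in>E. \<forall>y\<in>E. \<kappa> \<le> dist (\<phi> i x) (\<phi> j y))))"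

lemma gap_pos: "0 < gap"
  and gap_le: "i \<in> I \<Longrightarrow> j \<in> I \<Longrightarrow> i \<noteq> j \<Longrightarrow> x \<in> E \<Longrightarrow> y \<in> E \<Longrightarrow> gap \<le> dist (\<phi> i x) (\<phi> j y)"
  using someI_ex[OF ex_gap] unfolding gap_def by blast+

definition is_address :: "'a \<Rightarrow> (nat \<Rightarrow> 'i) \<Rightarrow> bool" where
  "is_address x \<omega> \<longleftrightarrow> (\<forall>k. \<omega> k \<in> I \<and> x \<in> cylinder_map \<phi> \<omega> k ` E)"

definition cylinder_ratio :: "(nat \<Rightarrow> 'i) \<Rightarrow> nat \<Rightarrow> real" where
  "cylinder_ratio \<omega> k = (\<Prod>j<k. r (\<omega> j))"

text \<open>Iterating the expanding inverse branches from \<open>x\<close> produces the address.\<close>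

lemma ex_address:
  assumes "x \<in> E"
  shows "\<exists>\<omega>. is_address x \<omega>"
proof -
  have "\<forall>y\<in>E. \<exists>i z. i \<in> I \<and> z \<in> E \<and> y = \<phi> i z" using E_eq by blast
  then obtain c T where cT: "\<And>y. y \<in> E \<Longrightarrow> c y \<in> I \<and> T y \<in> E \<and> y = \<phi> (c y) (T y)" by metis
  define X where "X k = (T ^^ k) x" for k
  have X: "X k \<in> E" for k by (induction k) (use assms cT in \<open>auto simp: X_def\<close>)
  have "x = cylinder_map \<phi> (\<lambda>k. c (X k)) k (X k)" for k
  proof (induction k)
    case (Suc k)
    have "\<phi> (c (X k)) (X (Suc k)) = X k" using cT[OF X[of k]] by (simp add: X_def)
    then show ?case using Suc by simp
  qed (simp add: X_def)
  then have "is_address x (\<lambda>k. c (X k))" using X cT by (auto simp: is_address_def)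
  then show ?thesis by blast
qed

context
  fixes \<omega> :: "nat \<Rightarrow> 'i" and x :: 'a
  assumes address: "is_address x \<omega>"
begin

lemma address_in_I: "\<omega> k \<in> I"
  using address by (simp add: is_address_def)

lemma dist_cylinder_map:
  "dist (cylinder_map \<phi> \<omega> k y) (cylinder_map \<phi> \<omega> k z) = cylinder_ratio \<omega> k * dist y z"
  by (induction k arbitrary: y z) (simp_all add: cylinder_ratio_def dist_\<phi> address_in_I)

lemma cylinder_ratio_pos: "0 < cylinder_ratio \<omega> k"
  by (simp add: cylinder_ratio_def prod_pos r_pos address_in_I)

lemma cylinder_ratio_antimono: "m \<le> k \<Longrightarrow> cylinder_ratio \<omega> k \<le> cylinder_ratio \<omega> m"
proof (rule lift_Suc_antimono_le[of "cylinder_ratio \<omega>"])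
  fix k
  have "cylinder_ratio \<omega> k * r (\<omega> k) \<le> cylinder_ratio \<omega> k * 1"
    using cylinder_ratio_pos r_less_1 address_in_I by (intro mult_left_mono) (auto simp: less_imp_le)
  then show "cylinder_ratio \<omega> (Suc k) \<le> cylinder_ratio \<omega> k" by (simp add: cylinder_ratio_def)
qed

lemma cylinder_ratio_le_1: "cylinder_ratio \<omega> k \<le> 1"
  using cylinder_ratio_antimono[of 0 k] by (simp add: cylinder_ratio_def)

lemma cylinder_ratio_tendsto_0: "cylinder_ratio \<omega> \<longlonglongrightarrow> 0"
proof -
  define M where "M = Max (r ` I)"
  have "I \<noteq> {}" using address_in_I by blast
  then have M: "M < 1" "\<And>i. i \<in> I \<Longrightarrow> r i \<le> M"
    using finite_I r_less_1 by (auto simp: M_def)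
  then have "0 \<le> M" using r_pos[OF address_in_I[of 0]] M(2)[OF address_in_I[of 0]] by simp
  have "cylinder_ratio \<omega> k \<le> M ^ k" for k
  proof -
    have "cylinder_ratio \<omega> k \<le> (\<Prod>j<k. M)" unfolding cylinder_ratio_def
      using M r_pos address_in_I by (intro prod_mono) (auto simp: less_imp_le)
    then show ?thesis by simp
  qed
  moreover have "(\<lambda>k. M ^ k) \<longlonglongrightarrow> 0" using M \<open>0 \<le> M\<close> by (intro LIMSEQ_power_zero) auto
  ultimately show ?thesis
    using cylinder_ratio_pos
    by (intro tendsto_sandwich[of "\<lambda>_. 0" "cylinder_ratio \<omega>" _ "\<lambda>k. M ^ k"] always_eventually)
       (simp_all add: less_imp_le)
qed

text \<open>Strong separation, scaled down: distinct pieces inside a cylinder of ratio \<open>R\<close> are at least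
  \<open>gap * R\<close> apart, so a nearby point of \<open>E\<close> cannot leave the cylinders around \<open>x\<close>.\<close>

lemma near_point_in_cylinder:
  assumes "y \<in> E" and "\<And>m. m < k \<Longrightarrow> dist x y < gap * cylinder_ratio \<omega> m"
  shows "y \<in> cylinder_map \<phi> \<omega> k ` E"
  using assms(2)
proof (induction k)
  case 0
  then show ?case using \<open>y \<in> E\<close> by simp
next
  case (Suc k)
  then obtain y' where y': "y' \<in> E" "y = cylinder_map \<phi> \<omega> k y'" by fastforce
  obtain j y'' where y'': "j \<in> I" "y'' \<in> E" "y' = \<phi> j y''" using y'(1) E_eq by blast
  have "x \<in> cylinder_map \<phi> \<omega> (Suc k) ` E" using address by (simp only: is_address_def)
  then obtain x' where x': "x' \<in> E" "x = cylinder_map \<phi> \<omega> k (\<phi> (\<omega> k) x')" by auto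
  have "cylinder_ratio \<omega> k * dist (\<phi> (\<omega> k) x') y' < cylinder_ratio \<omega> k * gap"
    using Suc.prems[of k] x' y' by (simp add: dist_cylinder_map mult.commute)
  then have "dist (\<phi> (\<omega> k) x') (\<phi> j y'') < gap"
    using cylinder_ratio_pos[of k] y'' by simp
  then have "j = \<omega> k" using gap_le[of "\<omega> k" j x' y''] address_in_I x' y'' by force
  then show ?case using y' y'' by auto
qed

end

text \<open>The copy is the first cylinder around \<open>x\<close> whose ratio drops below \<open>d / gap\<close>; all
  its predecessors are large enough to trap the ball.\<close>

lemma ball_in_small_copy:
  assumes "x \<in> E" and "0 < d"
  obtains f R where "0 < R" and "R < d / gap" and "\<And>y z. dist (f y) (f z) = R * dist y z"
    and "E \<inter> ball x d \<subseteq> f ` E"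
proof -
  obtain \<omega> where \<omega>: "is_address x \<omega>" using ex_address \<open>x \<in> E\<close> by blast
  have "eventually (\<lambda>k. cylinder_ratio \<omega> k < d / gap) sequentially"
    using cylinder_ratio_tendsto_0[OF \<omega>] \<open>0 < d\<close> gap_pos by (intro order_tendstoD(2)) auto
  then have ex: "\<exists>k. cylinder_ratio \<omega> k < d / gap" by (auto simp: eventually_sequentially)
  define k where "k = (LEAST k. cylinder_ratio \<omega> k < d / gap)"
  have less: "cylinder_ratio \<omega> k < d / gap" unfolding k_def using ex by (rule LeastI_ex)
  have before: "d \<le> gap * cylinder_ratio \<omega> m" if "m < k" for m
  proof -
    have "\<not> cylinder_ratio \<omega> m < d / gap" using that not_less_Least unfolding k_def by blast
    then show ?thesis using gap_pos by (simp add: field_simps not_less)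
  qed
  show thesis
  proof
    show "E \<inter> ball x d \<subseteq> cylinder_map \<phi> \<omega> k ` E"
    proof
      fix y assume "y \<in> E \<inter> ball x d"
      then show "y \<in> cylinder_map \<phi> \<omega> k ` E"
        using before by (intro near_point_in_cylinder[OF \<omega>]) (force simp: less_le_trans)+
    qed
  qed (use less cylinder_ratio_pos[OF \<omega>] dist_cylinder_map[OF \<omega>] in auto)
qed


end


section \<open>Covering numbers and Hausdorff measure\<close>

lemma empty_of_hausdorff_measure_0:
  assumes "hausdorff_measure 0 E = 0"
  shows "E = {}"
proof (rule ccontr)
  assume "E \<noteq> {}"
  then obtain e where e: "e \<in> E" by blast
  have "hausdorff_premeasure 1 0 E \<le> hausdorff_measure 0 E"
    unfolding hausdorff_measure_def by (intro SUP_upper) simp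
  then have "hausdorff_premeasure 1 0 E < 1" using assms by simp
  then obtain U :: "nat \<Rightarrow> 'a set" where U: "E \<subseteq> (\<Union>k. U k)" "(\<Sum>k. diam_pow 0 (U k)) < 1"
    unfolding hausdorff_premeasure_def by (auto simp: INF_less_iff)
  obtain k where "e \<in> U k" using U e by blast
  then have "1 = (\<Sum>j\<in>{k}. diam_pow 0 (U j))" by (auto simp: diam_pow_def)
  also have "\<dots> \<le> (\<Sum>k. diam_pow 0 (U k))" by (intro sum_le_suminf) auto
  finally show False using U(2) by simp
qed

text \<open>Each set of an efficient cover is put into a ball whose radius slightly exceeds its diameter,
  so that compactness applies and the radii are positive even for covering sets that are single
  points.\<close>

lemma small_balls_of_hausdorff_null:
  fixes E :: "'a::metric_space set"
  assumes "compact E" and null: "hausdorff_measure s E = 0" and "0 < s" and "0 < \<eta>"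
  obtains K :: "nat set" and c :: "nat \<Rightarrow> 'a" and d :: "nat \<Rightarrow> real"
  where "finite K" and "\<And>k. k \<in> K \<Longrightarrow> c k \<in> E" and "\<And>k. k \<in> K \<Longrightarrow> 0 < d k"
    and "E \<subseteq> (\<Union>k\<in>K. ball (c k) (d k))" and "(\<Sum>k\<in>K. d k powr s) < \<eta>"
proof -
  have "hausdorff_premeasure 1 s E \<le> hausdorff_measure s E"
    unfolding hausdorff_measure_def by (intro SUP_upper) simp
  then have "hausdorff_premeasure 1 s E < ennreal (\<eta> / 2)" using null \<open>0 < \<eta>\<close> by simp
  then obtain U :: "nat \<Rightarrow> 'a set" where U: "E \<subseteq> (\<Union>k. U k)" "\<And>k. bounded (U k)"
      "(\<Sum>k. diam_pow s (U k)) < ennreal (\<eta> / 2)"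
    unfolding hausdorff_premeasure_def by (auto simp: INF_less_iff)
  \<comment> \<open>The radius is chosen by its \<open>s\<close>-th power; the surcharges sum to \<open>\<eta> / 4\<close>.\<close>
  define d where "d k = (diameter (U k) powr s + \<eta> / 8 * (1 / 2) ^ k) powr (1 / s)" for k
  define c where "c k = (SOME x. x \<in> U k \<inter> E)" for k
  define K\<^sub>0 where "K\<^sub>0 = {k. U k \<inter> E \<noteq> {}}"
  have ds: "d k powr s = diameter (U k) powr s + \<eta> / 8 * (1 / 2) ^ k" for k
    using \<open>0 < s\<close> \<open>0 < \<eta>\<close> by (simp add: d_def powr_powr)
  have diam_d: "diameter (U k) < d k" for k
  proof (rule ccontr)
    assume "\<not> diameter (U k) < d k"
    then have "d k powr s \<le> diameter (U k) powr s" using \<open>0 < s\<close> by (intro powr_mono2) (auto simp: d_def)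
    moreover have "0 < \<eta> / 8 * (1 / 2) ^ k" using \<open>0 < \<eta>\<close> by simp
    ultimately show False using ds[of k] by linarith
  qed
  have d_pos: "0 < d k" for k using diam_d[of k] diameter_ge_0[OF U(2)[of k]] by simp
  have c: "c k \<in> U k" "c k \<in> E" if "k \<in> K\<^sub>0" for k
    using that someI_ex[of "\<lambda>x. x \<in> U k \<inter> E"] by (auto simp: K\<^sub>0_def c_def)
  have "E \<subseteq> (\<Union>k\<in>K\<^sub>0. ball (c k) (d k))"
  proof
    fix y assume "y \<in> E"
    then obtain k where k: "y \<in> U k" using U(1) by blast
    then have "k \<in> K\<^sub>0" using \<open>y \<in> E\<close> by (auto simp: K\<^sub>0_def)
    have "dist (c k) y \<le> diameter (U k)" using c(1)[OF \<open>k \<in> K\<^sub>0\<close>] k U(2)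
      by (intro diameter_bounded_bound) auto
    then have "y \<in> ball (c k) (d k)" using diam_d[of k] by simp
    then show "y \<in> (\<Union>k\<in>K\<^sub>0. ball (c k) (d k))" using \<open>k \<in> K\<^sub>0\<close> by blast
  qed
  then obtain K where K: "K \<subseteq> K\<^sub>0" "finite K" "E \<subseteq> (\<Union>k\<in>K. ball (c k) (d k))"
    using compactE_image[OF \<open>compact E\<close>, of K\<^sub>0 "\<lambda>k. ball (c k) (d k)"] by auto
  have "diam_pow s (U k) = ennreal (diameter (U k) powr s)" if "k \<in> K" for k
    using that \<open>0 < s\<close> K(1) by (auto simp: diam_pow_def K\<^sub>0_def)
  then have "ennreal (\<Sum>k\<in>K. diameter (U k) powr s) = (\<Sum>k\<in>K. diam_pow s (U k))"
    by (simp add: sum_ennreal)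
  also have "\<dots> \<le> (\<Sum>k. diam_pow s (U k))" using K(2) by (intro sum_le_suminf) auto
  also have "\<dots> < ennreal (\<eta> / 2)" by (rule U(3))
  finally have 1: "(\<Sum>k\<in>K. diameter (U k) powr s) < \<eta> / 2"
    by (simp add: ennreal_less_iff sum_nonneg)
  have "(\<Sum>k\<in>K. (1 / 2) ^ k) \<le> (\<Sum>k. (1 / 2 :: real) ^ k)"
    using K(2) by (intro sum_le_suminf summable_geometric) auto
  also have "\<dots> = 2" by (subst suminf_geometric) auto
  finally have 2: "\<eta> / 8 * (\<Sum>k\<in>K. (1 / 2) ^ k) \<le> \<eta> / 8 * 2" using \<open>0 < \<eta>\<close> by (intro mult_left_mono) auto
  have "(\<Sum>k\<in>K. d k powr s) = (\<Sum>k\<in>K. diameter (U k) powr s) + \<eta> / 8 * (\<Sum>k\<in>K. (1 / 2) ^ k)"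
    by (simp only: ds sum.distrib sum_distrib_left)
  then have "(\<Sum>k\<in>K. d k powr s) < \<eta>" using 1 2 \<open>0 < \<eta>\<close> by linarith
  then show thesis using that[of K c d] K c d_pos by blast
qed

text \<open>For a self-similar set with separated pieces, the covering numbers are controlled by the
  Hausdorff measure. By compactness and nullity \<open>E\<close> is covered by finitely many tiny balls, and the
  part of \<open>E\<close> in each ball lies in a copy of \<open>E\<close> of comparable size, with ratio \<open>R k\<close>. A cover of \<open>E\<close>
  at scale \<open>\<delta> / R k\<close> is carried to a cover of this copy at scale \<open>\<delta>\<close>. The estimate therefore
  propagates from coarse to fine scales, and its constant survives because the sum of the \<open>R k powr s\<close>
  is at most 1.\<close>

context separated_self_similar
begin

lemma covering_numbers_of_hausdorff_null:
  assumes null: "hausdorff_measure s E = 0" and s: "0 < s"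
  obtains K where "0 < K"
    and "\<And>\<delta>. 0 < \<delta> \<Longrightarrow> \<delta> \<le> 1 \<Longrightarrow>
      \<exists>X. finite X \<and> E \<subseteq> (\<Union>x\<in>X. ball x \<delta>) \<and> card X \<le> K * \<delta> powr (- s)"
proof -
  \<comment> \<open>This bound on the sum of the \<open>d k powr s\<close> serves twice: it makes every ratio \<open>d k / gap\<close> at
      most \<open>1 / 2\<close>, and the \<open>s\<close>-th powers of these ratios sum to at most 1.\<close>
  have "0 < (gap / 2) powr s" using gap_pos by simp
  then obtain Z :: "nat set" and c :: "nat \<Rightarrow> 'a" and d :: "nat \<Rightarrow> real"
    where Z: "finite Z" "\<And>k. k \<in> Z \<Longrightarrow> c k \<in> E" "\<And>k. k \<in> Z \<Longrightarrow> 0 < d k"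
      "E \<subseteq> (\<Union>k\<in>Z. ball (c k) (d k))" "(\<Sum>k\<in>Z. d k powr s) < (gap / 2) powr s"
    by (rule small_balls_of_hausdorff_null[OF compact_E null s]) blast
  have "\<exists>f R. 0 < R \<and> R < d k / gap \<and> (\<forall>y z. dist (f y) (f z) = R * dist y z) \<and>
      E \<inter> ball (c k) (d k) \<subseteq> f ` E" if "k \<in> Z" for k
    using ball_in_small_copy[OF Z(2)[OF that] Z(3)[OF that]] by metis
  then obtain f R where R: "\<And>k. k \<in> Z \<Longrightarrow> 0 < R k" "\<And>k. k \<in> Z \<Longrightarrow> R k < d k / gap"
    and f: "\<And>k y z. k \<in> Z \<Longrightarrow> dist (f k y) (f k z) = R k * dist y z"
      "\<And>k. k \<in> Z \<Longrightarrow> E \<inter> ball (c k) (d k) \<subseteq> f k ` E"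
    by metis
  have d_le: "d k < gap / 2" if "k \<in> Z" for k
  proof (rule ccontr)
    assume "\<not> d k < gap / 2"
    then have "(gap / 2) powr s \<le> d k powr s" using s gap_pos by (intro powr_mono2) auto
    also have "\<dots> \<le> (\<Sum>k\<in>Z. d k powr s)" using that Z(1) by (intro member_le_sum) auto
    finally show False using Z(5) by simp
  qed
  have R_half: "R k \<le> 1 / 2" if "k \<in> Z" for k
  proof -
    have "d k / gap \<le> 1 / 2" using d_le[OF that] gap_pos by (simp add: field_simps)
    then show ?thesis using R(2)[OF that] by linarith
  qed
  have sum_R: "(\<Sum>k\<in>Z. R k powr s) \<le> 1"
  proof -
    have "(\<Sum>k\<in>Z. R k powr s) \<le> (\<Sum>k\<in>Z. d k powr s / gap powr s)"
    proof (rule sum_mono)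
      fix k assume k: "k \<in> Z"
      have "R k powr s \<le> (d k / gap) powr s" using R[OF k] s by (intro powr_mono2) auto
      then show "R k powr s \<le> d k powr s / gap powr s" using gap_pos Z(3)[OF k] by (simp add: powr_divide)
    qed
    also have "\<dots> = (\<Sum>k\<in>Z. d k powr s) / gap powr s" by (simp add: sum_divide_distrib)
    also have "(gap / 2) powr s \<le> gap powr s" using gap_pos s by (intro powr_mono2) auto
    then have "(\<Sum>k\<in>Z. d k powr s) / gap powr s \<le> 1" using Z(5) gap_pos by simp
    finally show ?thesis .
  qed
  \<comment> \<open>Scales above \<open>\<delta>\<^sub>0\<close> are the coarse ones; below \<open>\<delta>\<^sub>0\<close> the rescaled values \<open>\<delta> / R k\<close> are still
      at most 1.\<close>
  define \<delta>\<^sub>0 where "\<delta>\<^sub>0 = Min (insert 1 (R ` Z))"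
  have \<delta>\<^sub>0: "0 < \<delta>\<^sub>0" "\<And>k. k \<in> Z \<Longrightarrow> \<delta>\<^sub>0 \<le> R k" using R Z(1) by (auto simp: \<delta>\<^sub>0_def)
  obtain X\<^sub>0 where X\<^sub>0: "finite X\<^sub>0" "E \<subseteq> (\<Union>x\<in>X\<^sub>0. ball x \<delta>\<^sub>0)"
  proof -
    have "E \<subseteq> (\<Union>x\<in>E. ball x \<delta>\<^sub>0)" using \<delta>\<^sub>0(1) by auto
    from compactE_image[OF compact_E _ this] show thesis using that by (metis open_ball)
  qed
  define K where "K = max 1 (real (card X\<^sub>0))"
  have K: "1 \<le> K" "card X\<^sub>0 \<le> K" by (auto simp: K_def)
  have coarse: "\<exists>X. finite X \<and> E \<subseteq> (\<Union>x\<in>X. ball x \<delta>) \<and> card X \<le> K * \<delta> powr (- s)"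
    if "\<delta>\<^sub>0 \<le> \<delta>" "\<delta> \<le> 1" for \<delta>
  proof (intro exI conjI)
    have "\<delta> powr 0 \<le> \<delta> powr (- s)" using that \<delta>\<^sub>0(1) s by (intro powr_mono') auto
    then have "1 \<le> \<delta> powr (- s)" using that \<delta>\<^sub>0(1) by simp
    then have "K * 1 \<le> K * \<delta> powr (- s)" using K by (intro mult_left_mono) auto
    then show "card X\<^sub>0 \<le> K * \<delta> powr (- s)" using K by linarith
    show "E \<subseteq> (\<Union>x\<in>X\<^sub>0. ball x \<delta>)"
      by (rule subset_trans[OF X\<^sub>0(2)]) (intro UN_mono order_refl subset_ball that(1))
  qed (rule X\<^sub>0)
  have fine: "\<exists>X. finite X \<and> E \<subseteq> (\<Union>x\<in>X. ball x \<delta>) \<and> card X \<le> K * \<delta> powr (- s)"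
    if "\<delta>\<^sub>0 * (1 / 2) ^ n \<le> \<delta>" "\<delta> \<le> 1" for \<delta> n
    using that
  proof (induction n arbitrary: \<delta>)
    case 0
    then show ?case using coarse by simp
  next
    case (Suc n)
    show ?case
    proof (cases "\<delta>\<^sub>0 \<le> \<delta>")
      case True
      then show ?thesis using coarse Suc.prems by simp
    next
      case False
      have "0 < \<delta>\<^sub>0 * (1 / 2) ^ Suc n" using \<delta>\<^sub>0 by simp
      then have \<delta>: "0 < \<delta>" using Suc.prems(1) by linarith
      have "\<exists>X. finite X \<and> E \<subseteq> (\<Union>x\<in>X. ball x (\<delta> / R k)) \<and> card X \<le> K * (\<delta> / R k) powr (- s)"
        if k: "k \<in> Z" for k
      proof (rule Suc.IH)
        have "\<delta>\<^sub>0 * (1 / 2) ^ n \<le> 2 * \<delta>" using Suc.prems(1) by simp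
        also have "2 * \<delta> \<le> \<delta> / R k" using R_half[OF k] R(1)[OF k] \<delta> by (simp add: field_simps)
        finally show "\<delta>\<^sub>0 * (1 / 2) ^ n \<le> \<delta> / R k" .
        show "\<delta> / R k \<le> 1" using False \<delta>\<^sub>0(2)[OF k] R(1)[OF k] by (simp add: field_simps)
      qed
      then obtain X where X: "\<And>k. k \<in> Z \<Longrightarrow> finite (X k)"
          "\<And>k. k \<in> Z \<Longrightarrow> E \<subseteq> (\<Union>x\<in>X k. ball x (\<delta> / R k))"
          "\<And>k. k \<in> Z \<Longrightarrow> card (X k) \<le> K * (\<delta> / R k) powr (- s)"
        by metis
      define Y where "Y = (\<Union>k\<in>Z. f k ` X k)"
      have "E \<subseteq> (\<Union>y\<in>Y. ball y \<delta>)"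
      proof
        fix e assume e: "e \<in> E"
        then obtain k where k: "k \<in> Z" "e \<in> f k ` E" using Z(4) f(2) by blast
        then obtain e' where e': "e' \<in> E" "e = f k e'" by blast
        then obtain x where x: "x \<in> X k" "dist x e' < \<delta> / R k" using X(2)[OF k(1)] by auto
        have "R k * dist x e' < \<delta>" using x(2) R(1)[OF k(1)] by (simp add: field_simps)
        then have "e \<in> ball (f k x) \<delta>" using f(1)[OF k(1)] e' by simp
        then show "e \<in> (\<Union>y\<in>Y. ball y \<delta>)" using k x by (auto simp: Y_def)
      qed
      moreover have "finite Y" using Z(1) X(1) by (auto simp: Y_def)
      moreover have "card Y \<le> K * \<delta> powr (- s)"
      proof -
        have "card Y \<le> (\<Sum>k\<in>Z. card (f k ` X k))" unfolding Y_def using Z(1) by (rule card_UN_le)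
        also have "\<dots> \<le> (\<Sum>k\<in>Z. card (X k))" using X(1) by (intro sum_mono card_image_le) auto
        finally have "real (card Y) \<le> (\<Sum>k\<in>Z. real (card (X k)))" by (simp flip: of_nat_sum)
        also have "\<dots> \<le> (\<Sum>k\<in>Z. K * \<delta> powr (- s) * R k powr s)"
        proof (rule sum_mono)
          fix k assume k: "k \<in> Z"
          have "(\<delta> / R k) powr (- s) = \<delta> powr (- s) * R k powr s"
            using \<delta> R(1)[OF k] by (simp add: powr_divide powr_minus_divide)
          then show "real (card (X k)) \<le> K * \<delta> powr (- s) * R k powr s" using X(3)[OF k] by (simp add: mult.assoc)
        qed
        also have "\<dots> = K * \<delta> powr (- s) * (\<Sum>k\<in>Z. R k powr s)" by (simp add: sum_distrib_left)
        also have "\<dots> \<le> K * \<delta> powr (- s) * 1" using sum_R K by (intro mult_left_mono) auto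
        finally show ?thesis by simp
      qed
      ultimately show ?thesis by blast
    qed
  qed
  show thesis
  proof
    show "0 < K" using K by simp
    fix \<delta> :: real assume \<delta>: "0 < \<delta>" "\<delta> \<le> 1"
    obtain n where "(1 / 2) ^ n < \<delta> / \<delta>\<^sub>0" using real_arch_pow_inv[of "\<delta> / \<delta>\<^sub>0" "1 / 2"] \<delta> \<delta>\<^sub>0(1) by auto
    then have "\<delta>\<^sub>0 * (1 / 2) ^ n \<le> \<delta>" using \<delta>\<^sub>0(1) by (simp add: field_simps)
    then show "\<exists>X. finite X \<and> E \<subseteq> (\<Union>x\<in>X. ball x \<delta>) \<and> card X \<le> K * \<delta> powr (- s)"
      using fine \<delta>(2) by blast
  qed
qed

section \<open>Geometric sequences inside a separated self-similar set\<close>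

text \<open>Blowing up the cylinder of level \<open>k\<close> around \<open>y\<close> to full size turns the pair \<open>y\<close>, \<open>z n\<close> into a pair
  of points of \<open>E\<close> whose distance is multiplied by the inverse of the cylinder ratio. For the
  first \<open>n\<close> at which the distance \<open>c * \<rho> ^ n\<close> drops below \<open>\<kappa>\<close> times the ratio, strong separation puts
  \<open>z n\<close> into this cylinder, and the blown-up distance lies between \<open>\<rho> * \<kappa>\<close> and \<open>\<kappa>\<close>.\<close>

lemma zoomed_pair:
  assumes \<omega>: "is_address y \<omega>"
    and z: "\<And>n. z n \<in> E" "\<And>n. dist y (z n) = c * \<rho> ^ n" and \<rho>: "0 < \<rho>" "\<rho> < 1"
    and \<kappa>: "0 < \<kappa>" "\<kappa> \<le> gap" "\<kappa> \<le> c"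
  obtains P P' n where "P \<in> E" and "P' \<in> E" and "\<rho> * \<kappa> \<le> dist P P'"
    and "dist P P' = c * \<rho> ^ n / cylinder_ratio \<omega> k"
proof -
  define R where "R = cylinder_ratio \<omega> k"
  have R: "0 < R" "R \<le> 1" using cylinder_ratio_pos[OF \<omega>] cylinder_ratio_le_1[OF \<omega>] by (auto simp: R_def)
  have c: "0 < c" using \<kappa> by simp
  have ex: "\<exists>n. c * \<rho> ^ n < \<kappa> * R"
  proof -
    obtain n where "\<rho> ^ n < \<kappa> * R / c" using real_arch_pow_inv[of "\<kappa> * R / c" \<rho>] \<kappa> R c \<rho> by auto
    then show ?thesis using c by (auto simp: field_simps)
  qed
  define n where "n = (LEAST n. c * \<rho> ^ n < \<kappa> * R)"
  have n: "c * \<rho> ^ n < \<kappa> * R" unfolding n_def using ex by (rule LeastI_ex)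
  \<comment> \<open>The condition \<open>\<kappa> \<le> c\<close> ensures \<open>n > 0\<close>, so that minimality bounds the distance from below.\<close>
  have "\<kappa> * R \<le> c * 1" using \<kappa> R c by (intro mult_mono) auto
  then have "n \<noteq> 0" using n by (intro notI) simp
  then obtain n' where n': "n = Suc n'" by (cases n) auto
  then have "\<not> c * \<rho> ^ n' < \<kappa> * R" using not_less_Least[of n' "\<lambda>n. c * \<rho> ^ n < \<kappa> * R"]
    by (simp flip: n_def)
  then have "\<rho> * (\<kappa> * R) \<le> \<rho> * (c * \<rho> ^ n')" using \<rho> by (intro mult_left_mono) auto
  then have lower: "\<rho> * \<kappa> \<le> c * \<rho> ^ n / R" using R unfolding n' by (simp add: field_simps)
  obtain P where P: "P \<in> E" "y = cylinder_map \<phi> \<omega> k P" using \<omega> by (auto simp: is_address_def)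
  have "z n \<in> cylinder_map \<phi> \<omega> k ` E"
  proof (rule near_point_in_cylinder[OF \<omega> z(1)])
    fix m assume "m < k"
    have "\<kappa> * R \<le> gap * cylinder_ratio \<omega> m"
      using \<kappa> R cylinder_ratio_antimono[OF \<omega>, of m k] \<open>m < k\<close> gap_pos unfolding R_def by (intro mult_mono) auto
    then show "dist y (z n) < gap * cylinder_ratio \<omega> m" using n z(2) by simp
  qed
  then obtain P' where P': "P' \<in> E" "z n = cylinder_map \<phi> \<omega> k P'" by blast
  have "R * dist P P' = c * \<rho> ^ n" using z(2)[of n] P P' dist_cylinder_map[OF \<omega>] by (simp add: R_def)
  then have "dist P P' = c * \<rho> ^ n / R" using R by (simp add: field_simps)
  then show thesis using that[of P P' n] P P' lower by (simp add: R_def)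
qed

text \<open>The logarithm to base \<open>\<rho>\<close> of the distance produced at level \<open>k\<close> equals, up to a constant and an
  integer, \<open>- ln (cylinder_ratio \<omega> k) / ln \<rho>\<close>. Separation of these numbers modulo 1 separates the
  distances, as they stay away from 0. A cover of \<open>E\<close> at a finer scale by \<open>X\<close> then distinguishes the
  pairs, and there are only \<open>card X ^ 2\<close> pairs of covering balls.\<close>

lemma card_separated_times_le:
  assumes \<omega>: "is_address y \<omega>"
    and z: "\<And>n. z n \<in> E" "\<And>n. dist y (z n) = c * \<rho> ^ n" and \<rho>: "0 < \<rho>" "\<rho> < 1"
    and \<kappa>: "0 < \<kappa>" "\<kappa> \<le> gap" "\<kappa> \<le> c"
    and S: "separated_mod1 \<delta> (\<lambda>k. - ln (cylinder_ratio \<omega> k) / ln \<rho>) S"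
    and X: "finite X" "E \<subseteq> (\<Union>x\<in>X. ball x \<epsilon>)" and \<epsilon>: "4 * \<epsilon> \<le> \<rho> * \<kappa> * (- ln \<rho>) * \<delta>"
  shows "card S \<le> card X ^ 2"
proof -
  define R where "R = cylinder_ratio \<omega>"
  have R: "0 < R k" for k using cylinder_ratio_pos[OF \<omega>] by (simp add: R_def)
  have c: "0 < c" using \<kappa> by simp
  have ln\<rho>: "ln \<rho> < 0" using \<rho> by simp
  have "\<exists>P P' n. P \<in> E \<and> P' \<in> E \<and> \<rho> * \<kappa> \<le> dist P P' \<and> dist P P' = c * \<rho> ^ n / R k" for k
    using zoomed_pair[OF \<omega> z \<rho> \<kappa>, of k] unfolding R_def by metis
  then obtain P P' n where P: "\<And>k. P k \<in> E" "\<And>k. P' k \<in> E"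
      "\<And>k. \<rho> * \<kappa> \<le> dist (P k) (P' k)" "\<And>k. dist (P k) (P' k) = c * \<rho> ^ n k / R k"
    by metis
  define L where "L k = dist (P k) (P' k)" for k
  have L: "\<rho> * \<kappa> \<le> L k" "0 < L k" "L k = c * \<rho> ^ n k / R k" for k
  proof -
    show "\<rho> * \<kappa> \<le> L k" "L k = c * \<rho> ^ n k / R k" using P by (auto simp: L_def)
    then show "0 < L k" using mult_pos_pos[OF \<rho>(1) \<kappa>(1)] by linarith
  qed
  have ln_L: "ln (L k) = ln c + ln \<rho> * (n k + (- ln (R k) / ln \<rho>))" for k
  proof -
    have "ln (L k) = ln c + n k * ln \<rho> - ln (R k)"
      unfolding L(3) using c \<rho> R[of k] by (simp add: ln_div ln_mult ln_realpow)
    moreover have "ln \<rho> * (n k + (- ln (R k) / ln \<rho>)) = n k * ln \<rho> - ln (R k)"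
      using less_imp_neq[OF ln\<rho>] by (simp add: right_diff_distrib)
    ultimately show ?thesis by simp
  qed
  have L_sep: "\<rho> * \<kappa> * (- ln \<rho>) * \<delta> \<le> \<bar>L k - L l\<bar>" if kl: "k \<in> S" "l \<in> S" "k \<noteq> l" for k l
  proof -
    have ln_diff: "ln a - ln b \<le> \<bar>a - b\<bar> / (\<rho> * \<kappa>)" if "\<rho> * \<kappa> \<le> b" "0 < a" "0 < b" for a b
    proof -
      have "ln a - ln b = ln (a / b)" using that by (simp add: ln_div)
      also have "\<dots> \<le> a / b - 1" using that by (intro ln_le_minus_one) auto
      also have "\<dots> = (a - b) / b" using that by (simp add: field_simps)
      also have "\<dots> \<le> \<bar>a - b\<bar> / b" using that by (intro divide_right_mono) auto
      also have "\<dots> \<le> \<bar>a - b\<bar> / (\<rho> * \<kappa>)" using that \<rho> \<kappa> by (intro divide_left_mono) auto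
      finally show ?thesis .
    qed
    define x where "x k = - ln (R k) / ln \<rho>" for k
    have "\<delta> \<le> \<bar>x k - x l - of_int (int (n l) - int (n k))\<bar>"
      using S kl unfolding separated_mod1_def x_def R_def by blast
    then have "(- ln \<rho>) * \<delta> \<le> (- ln \<rho>) * \<bar>x k - x l - of_int (int (n l) - int (n k))\<bar>"
      using ln\<rho> by (intro mult_left_mono) auto
    also have "\<dots> = \<bar>ln \<rho> * (x k - x l - of_int (int (n l) - int (n k)))\<bar>" using ln\<rho> by (simp add: abs_mult)
    also have "ln \<rho> * (x k - x l - of_int (int (n l) - int (n k))) = ln (L k) - ln (L l)"
      unfolding ln_L x_def by (simp add: algebra_simps)
    also have "\<bar>ln (L k) - ln (L l)\<bar> \<le> \<bar>L k - L l\<bar> / (\<rho> * \<kappa>)"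
      using ln_diff[of "L l" "L k"] ln_diff[of "L k" "L l"] L(1,2)[of k] L(1,2)[of l]
      by (simp add: abs_le_iff abs_minus_commute)
    finally show ?thesis using \<rho> \<kappa> by (simp add: field_simps)
  qed
  have "\<forall>e\<in>E. \<exists>x. x \<in> X \<and> e \<in> ball x \<epsilon>" using X(2) by blast
  then obtain i where i: "\<forall>e\<in>E. i e \<in> X \<and> e \<in> ball (i e) \<epsilon>" by (rule bchoice[THEN exE])
  have close: "dist e e' < 2 * \<epsilon>" if "e \<in> E" "e' \<in> E" "i e = i e'" for e e'
  proof -
    have "dist (i e) e < \<epsilon>" "dist (i e') e' < \<epsilon>" using i that by auto
    then show ?thesis using that(3) dist_triangle3[of e e' "i e"] by simp
  qed
  have "inj_on (\<lambda>k. (i (P k), i (P' k))) S"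
  proof (rule inj_onI, rule ccontr)
    fix k l assume kl: "k \<in> S" "l \<in> S" "(i (P k), i (P' k)) = (i (P l), i (P' l))" "k \<noteq> l"
    have "dist (P k) (P l) < 2 * \<epsilon>" "dist (P' k) (P' l) < 2 * \<epsilon>" using close P kl by auto
    moreover have "\<bar>L k - L l\<bar> \<le> dist (P k) (P l) + dist (P' k) (P' l)"
      unfolding L_def
      using dist_triangle[of "P k" "P' k" "P l"] dist_triangle[of "P l" "P' k" "P' l"]
        dist_triangle[of "P l" "P' l" "P k"] dist_triangle[of "P k" "P' l" "P' k"]
      by (simp add: dist_commute)
    ultimately show False using L_sep[OF kl(1,2,4)] \<epsilon> by linarith
  qed
  moreover have "(\<lambda>k. (i (P k), i (P' k))) ` S \<subseteq> X \<times> X" using i P by auto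
  ultimately have "card S \<le> card (X \<times> X)" using X(1) by (metis card_image card_mono finite_cartesian_product)
  then show ?thesis by (simp add: card_cartesian_product power2_eq_square)
qed

end

text \<open>The cylinder ratios along the address of \<open>y\<close> are products of \<open>r\<^sub>1\<close> and \<open>r\<^sub>2\<close>, so their
  logarithms to base \<open>\<rho>\<close>, with the opposite sign, form an orbit of the two steps
  \<open>- (ln r\<^sub>1 / ln \<rho>)\<close> and \<open>- (ln r\<^sub>2 / ln \<rho>)\<close>. At some scale this orbit has more separated points than
  the number of pairs of balls covering \<open>E\<close> allows.\<close>

theorem (in separated_self_similar) no_geometric_sequence:
  assumes dim: "hausdorff_dim E < ereal (1 / 2 * (1 - 2 * (\<tau>\<^sub>1 - 1) / \<tau>\<^sub>2))"
    and ratios: "\<And>i. i \<in> I \<Longrightarrow> r i = r\<^sub>1 \<or> r i = r\<^sub>2"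
    and \<alpha>: "- (ln r\<^sub>1 / ln \<rho>) \<in> exact_order_set (ereal \<tau>\<^sub>1)" and \<beta>: "- (ln r\<^sub>2 / ln \<rho>) \<in> W \<tau>\<^sub>2"
    and \<tau>: "2 \<le> \<tau>\<^sub>1" "2 \<le> \<tau>\<^sub>2" and \<rho>: "0 < \<rho>" "\<rho> < 1"
    and "0 < l" and y: "y \<in> E" and z: "\<And>n::nat. z n \<in> E" "\<And>n. dist y (z n) = l * \<rho> ^ n"
  shows False
proof -
  obtain s where s: "0 \<le> s" "hausdorff_measure s E = 0" "s < 1 / 2 * (1 - 2 * (\<tau>\<^sub>1 - 1) / \<tau>\<^sub>2)"
    using dim unfolding hausdorff_dim_def Inf_less_iff by auto
  have "0 < s" using s(1,2) E_nonempty empty_of_hausdorff_measure_0[of E] by (cases "s = 0") auto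
  obtain K where K: "0 < K" "\<And>\<delta>. 0 < \<delta> \<Longrightarrow> \<delta> \<le> 1 \<Longrightarrow>
      \<exists>X. finite X \<and> E \<subseteq> (\<Union>x\<in>X. ball x \<delta>) \<and> card X \<le> K * \<delta> powr (- s)"
    using covering_numbers_of_hausdorff_null[OF s(2) \<open>0 < s\<close>] by blast
  obtain \<omega> where \<omega>: "is_address y \<omega>" using ex_address y by blast
  define \<kappa> where "\<kappa> = min gap l"
  have \<kappa>: "0 < \<kappa>" "\<kappa> \<le> gap" "\<kappa> \<le> l" using gap_pos \<open>0 < l\<close> by (auto simp: \<kappa>_def)
  \<comment> \<open>The factor \<open>c\<close> relates the scale on the circle to the scale of the cover.\<close>
  define c where "c = min 1 (\<rho> * \<kappa> * (- ln \<rho>) / 4)"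
  have "0 < - ln \<rho>" using \<rho> by simp
  then have "0 < \<rho> * \<kappa> * (- ln \<rho>)" using \<rho> \<kappa> by (intro mult_pos_pos)
  then have c: "0 < c" "c \<le> 1" "4 * c \<le> \<rho> * \<kappa> * (- ln \<rho>)" by (auto simp: c_def)
  define x where "x k = - ln (cylinder_ratio \<omega> k) / ln \<rho>" for k
  have orbit: "x (Suc k) = x k + - (ln r\<^sub>1 / ln \<rho>) \<or> x (Suc k) = x k + - (ln r\<^sub>2 / ln \<rho>)" for k
  proof -
    have "\<omega> k \<in> I" using address_in_I[OF \<omega>] .
    then have "0 < r (\<omega> k)" by (rule r_pos)
    moreover have "cylinder_ratio \<omega> (Suc k) = cylinder_ratio \<omega> k * r (\<omega> k)"
      by (simp add: cylinder_ratio_def)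
    ultimately have "ln (cylinder_ratio \<omega> (Suc k)) = ln (cylinder_ratio \<omega> k) + ln (r (\<omega> k))"
      using cylinder_ratio_pos[OF \<omega>, of k] by (simp add: ln_mult)
    then show ?thesis using ratios[OF \<open>\<omega> k \<in> I\<close>] by (auto simp: x_def diff_divide_distrib)
  qed
  have v: "0 \<le> 2 * s" "2 * s < 1 - 2 * (\<tau>\<^sub>1 - 1) / \<tau>\<^sub>2" using s by auto
  have "0 < \<tau>\<^sub>2" using \<tau> by simp
  from alpha_beta_orbit_separated_subset[OF \<alpha> \<beta> \<tau>(1) v this, of x "(K * c powr (- s)) ^ 2", OF orbit]
  obtain \<delta> S where \<delta>: "0 < \<delta>" "\<delta> \<le> 1" and S: "finite S" "separated_mod1 \<delta> x S"
    and big: "(K * c powr (- s)) ^ 2 * \<delta> powr (- (2 * s)) < card S"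
    by blast
  have c\<delta>: "0 < c * \<delta>" "c * \<delta> \<le> 1" using c \<delta> by (auto intro: mult_le_one)
  obtain X where X: "finite X" "E \<subseteq> (\<Union>x\<in>X. ball x (c * \<delta>))" "card X \<le> K * (c * \<delta>) powr (- s)"
    using K(2)[OF c\<delta>] by blast
  have "4 * (c * \<delta>) \<le> \<rho> * \<kappa> * (- ln \<rho>) * \<delta>"
    using mult_right_mono[OF c(3), of \<delta>] \<delta> by (simp add: mult.assoc)
  then have "card S \<le> card X ^ 2"
    using card_separated_times_le[OF \<omega> z \<rho> \<kappa> S(2)[unfolded x_def] X(1,2)] by blast
  then have "real (card S) \<le> real (card X) ^ 2" by (metis of_nat_le_iff of_nat_power)
  also have "\<dots> \<le> (K * (c * \<delta>) powr (- s)) ^ 2" using X(3) by (intro power_mono) auto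
  also have "\<dots> = (K * c powr (- s)) ^ 2 * \<delta> powr (- (2 * s))"
    using c \<delta> by (simp add: powr_mult power_mult_distrib powr_power)
  finally show False using big by simp
qed

section \<open>Affine images of self-similar sets\<close>

lemma homothety_funpow:
  fixes \<rho> :: real and t w :: "'a::real_vector"
  assumes "\<rho> \<noteq> 1"
  defines "c \<equiv> (1 / (1 - \<rho>)) *\<^sub>R t"
  shows "((\<lambda>x. \<rho> *\<^sub>R x + t) ^^ n) w = c + \<rho> ^ n *\<^sub>R (w - c)"
proof (induction n)
  case (Suc n)
  have "t = (1 - \<rho>) *\<^sub>R c" using assms by (simp add: c_def)
  then have "\<rho> *\<^sub>R c + t = c" by (simp add: algebra_simps)
  have "((\<lambda>x. \<rho> *\<^sub>R x + t) ^^ Suc n) w = \<rho> *\<^sub>R (c + \<rho> ^ n *\<^sub>R (w - c)) + t" using Suc by simp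
  also have "\<dots> = (\<rho> *\<^sub>R c + t) + \<rho> ^ Suc n *\<^sub>R (w - c)" by (simp add: scaleR_add_right)
  finally show ?case using \<open>\<rho> *\<^sub>R c + t = c\<close> by simp
qed simp

text \<open>The homothety makes \<open>F\<close> contain a sequence converging geometrically to its fixed point \<open>c\<close> along
  a ray, and an affine bijection preserves this configuration. The matrix multiplies all distances along the ray by the
  same factor.\<close>

lemma affine_image_geometric_sequence:
  fixes F :: "(real^'n) set" and M :: "real^'n^'n"
  assumes "closed F" and "F \<noteq> {}" and "\<nexists>x. F = {x}" and \<rho>: "0 < \<rho>" "\<rho> < 1"
    and self: "\<And>x. x \<in> F \<Longrightarrow> \<rho> *\<^sub>R x + t \<in> F"
    and "invertible M" and emb: "(\<lambda>x. M *v x + a) ` F \<subseteq> E"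
  obtains y z l where "y \<in> E" and "0 < l" and "\<And>n::nat. z n \<in> E" and "\<And>n. dist y (z n) = l * \<rho> ^ n"
proof -
  define c where "c = (1 / (1 - \<rho>)) *\<^sub>R t"
  obtain w where w: "w \<in> F" "w \<noteq> c" using assms(2,3) by blast
  have orbit: "c + \<rho> ^ n *\<^sub>R (w - c) \<in> F" for n
  proof -
    have "((\<lambda>x. \<rho> *\<^sub>R x + t) ^^ n) w \<in> F" by (induction n) (use w self in auto)
    then show ?thesis using homothety_funpow[of \<rho> n t w] \<rho> by (simp add: c_def)
  qed
  have "(\<lambda>n. c + \<rho> ^ n *\<^sub>R (w - c)) \<longlonglongrightarrow> c + 0 *\<^sub>R (w - c)"
    using \<rho> by (intro tendsto_intros LIMSEQ_power_zero) auto
  then have "c \<in> F" using closed_sequentially[OF \<open>closed F\<close> orbit] by simp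
  define f where "f x = M *v x + a" for x
  obtain M' where "M' ** M = mat 1" using \<open>invertible M\<close> by (auto simp: invertible_def)
  then have "M' *v (M *v (w - c)) = w - c" by (simp add: matrix_vector_mul_assoc)
  then have "M *v (w - c) \<noteq> 0" using w by auto
  show thesis
  proof
    show "f c \<in> E" using emb \<open>c \<in> F\<close> by (auto simp: f_def)
    show "0 < norm (M *v (w - c))" using \<open>M *v (w - c) \<noteq> 0\<close> by simp
    show "f (c + \<rho> ^ n *\<^sub>R (w - c)) \<in> E" for n using emb orbit by (auto simp: f_def)
    have "f c - f (c + \<rho> ^ n *\<^sub>R (w - c)) = - (\<rho> ^ n *\<^sub>R (M *v (w - c)))" for n
      by (simp add: f_def matrix_vector_right_distrib matrix_vector_mult_scaleR)
    then show "dist (f c) (f (c + \<rho> ^ n *\<^sub>R (w - c))) = norm (M *v (w - c)) * \<rho> ^ n" for n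
      using \<rho> by (simp add: dist_norm)
  qed
qed


theorem theorem4p2:
  fixes \<phi> :: "'i \<Rightarrow> real^'n \<Rightarrow> real^'n" and \<psi> :: "'j \<Rightarrow> real^'n \<Rightarrow> real^'n"
    and I I\<^sub>1 I\<^sub>2 :: "'i set" and J :: "'j set"
    and E F :: "(real^'n) set"
    and r\<^sub>1 r\<^sub>2 \<tau>\<^sub>1 \<tau>\<^sub>2 :: real
    and Q\<^sub>1 Q\<^sub>2 :: "'i \<Rightarrow> real^'n^'n" and t\<^sub>1 t\<^sub>2 :: "'i \<Rightarrow> real^'n"
    and r' :: "'j \<Rightarrow> real" and j\<^sub>s :: 'j and t\<^sub>s :: "real^'n"
  assumes "IFS I \<phi>" and "IFS J \<psi>"
    and "E = self_similar_set I \<phi>" and "F = self_similar_set J \<psi>"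
    and "\<nexists>x. F = {x}"
    and "\<forall>j\<in>J. r' j = contraction_ratio (\<psi> j)"
    and "strong_separation I \<phi>"
    and "r\<^sub>1 \<in> {0<..<1}" and "r\<^sub>2 \<in> {0<..<1}"
    and "I\<^sub>1 \<subseteq> I" and "I\<^sub>2 \<subseteq> I"
    and "\<forall>i\<in>I\<^sub>1. orthogonal_matrix (Q\<^sub>1 i)" and "\<forall>i\<in>I\<^sub>2. orthogonal_matrix (Q\<^sub>2 i)"
    and "\<phi> ` I = (\<lambda>i. sim_map r\<^sub>1 (Q\<^sub>1 i) (t\<^sub>1 i)) ` I\<^sub>1 \<union> (\<lambda>i. sim_map r\<^sub>2 (Q\<^sub>2 i) (t\<^sub>2 i)) ` I\<^sub>2"
    and "j\<^sub>s \<in> J" and "\<psi> j\<^sub>s = sim_map (r' j\<^sub>s) (mat 1) t\<^sub>s"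
    and "\<tau>\<^sub>1 \<ge> 2" and "\<tau>\<^sub>2 \<ge> 2" and "2 * \<tau>\<^sub>1 < \<tau>\<^sub>2 + 2"
    and "- (ln r\<^sub>1 / ln (r' j\<^sub>s)) \<in> exact_order_set (ereal \<tau>\<^sub>1)"
    and "- (ln r\<^sub>2 / ln (r' j\<^sub>s)) \<in> W \<tau>\<^sub>2"
    and "hausdorff_dim E < ereal (1 / 2 * (1 - 2 * (\<tau>\<^sub>1 - 1) / \<tau>\<^sub>2))"
  shows "\<not> affinely_embeds F E"
proof
  note E = self_similar_set[OF \<open>IFS I \<phi>\<close>, folded \<open>E = self_similar_set I \<phi>\<close>]
  note F = self_similar_set[OF \<open>IFS J \<psi>\<close>, folded \<open>F = self_similar_set J \<psi>\<close>]
  have ratios: "has_contraction_ratio (\<phi> i) r\<^sub>1 \<or> has_contraction_ratio (\<phi> i) r\<^sub>2" if "i \<in> I" for i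
  proof -
    have "\<phi> i \<in> (\<lambda>i. sim_map r\<^sub>1 (Q\<^sub>1 i) (t\<^sub>1 i)) ` I\<^sub>1 \<union> (\<lambda>i. sim_map r\<^sub>2 (Q\<^sub>2 i) (t\<^sub>2 i)) ` I\<^sub>2"
      using assms(14) that by blast
    then show ?thesis using assms(8,9,12,13) unfolding has_contraction_ratio_def by auto
  qed
  define r where "r i = contraction_ratio (\<phi> i)" for i
  have r: "has_contraction_ratio (\<phi> i) (r i)" "r i = r\<^sub>1 \<or> r i = r\<^sub>2" if "i \<in> I" for i
    using ratios[OF that] contraction_ratio_eq[of "\<phi> i"] by (auto simp: r_def)
  interpret separated_self_similar I \<phi> r E
  proof
    show "finite I" using \<open>IFS I \<phi>\<close> by (simp add: IFS_def)
    show "\<phi> i ` E \<inter> \<phi> j ` E = {}" if "i \<in> I" "j \<in> I" "i \<noteq> j" for i j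
      using \<open>strong_separation I \<phi>\<close> that by (simp add: strong_separation_def \<open>E = self_similar_set I \<phi>\<close>)
    show "dist (\<phi> i x) (\<phi> i y) = r i * dist x y" if "i \<in> I" for i x y
      by (rule has_contraction_ratio_dist[OF r(1)[OF that]])
    show "0 < r i" "r i < 1" if "i \<in> I" for i
      using r(1)[OF that] by (auto simp: has_contraction_ratio_def)
  qed (rule E)+
  define \<rho> where "\<rho> = r' j\<^sub>s"
  have "similarity (\<psi> j\<^sub>s)" using \<open>IFS J \<psi>\<close> \<open>j\<^sub>s \<in> J\<close> by (simp add: IFS_def)
  then obtain q where q: "has_contraction_ratio (\<psi> j\<^sub>s) q" by (auto simp: similarity_def)
  then have "\<rho> = q" using contraction_ratio_eq[OF q] assms(6,15) by (simp add: \<rho>_def)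
  then have \<rho>: "0 < \<rho>" "\<rho> < 1" using q by (auto simp: has_contraction_ratio_def)
  have self: "\<rho> *\<^sub>R x + t\<^sub>s \<in> F" if "x \<in> F" for x
  proof -
    have "\<psi> j\<^sub>s x \<in> F" using F(3) \<open>j\<^sub>s \<in> J\<close> that by blast
    then show ?thesis by (simp add: assms(16) sim_map_def \<rho>_def)
  qed
  assume "affinely_embeds F E"
  then obtain M a where M: "invertible M" "(\<lambda>x. M *v x + a) ` F \<subseteq> E" by (auto simp: affinely_embeds_def)
  show False
  proof (rule affine_image_geometric_sequence[OF compact_imp_closed[OF F(1)] F(2) assms(5) \<rho> self M])
    fix y l and z :: "nat \<Rightarrow> real^'n"
    assume "y \<in> E" "0 < l" "\<And>n. z n \<in> E" "\<And>n. dist y (z n) = l * \<rho> ^ n"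
    then show False
      using no_geometric_sequence[OF assms(22) r(2) assms(20,21)[folded \<rho>_def] assms(17,18) \<rho>]
      by blast
  qed
qed

end
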